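(* Let $\Omega\subset\mathbb{R}^N$, $N\ge 2$, be a bounded smooth domain. For every $p>N$ let $q(p)\in[1,\infty)$ be given, and let $u_{p,q(p)}$ be a positive Sobolev extremal function corresponding to $\lambda_{p,q(p)}$. Suppose that the limit $$r:=\lim_{p\to\infty}q(p)$$ exists and $r<\infty$. Then $$\lim_{p\to\infty}\lambda_{p,q(p)}^{1/p}=\|d_\Omega\|_r^{-1}$$ and $$\lim_{p\to\infty}u_{p,q(p)}=\frac{d_\Omega}{\|d_\Omega\|_r}\quad\text{uniformly in }\overline\Omega .$$
   Context: $\|\cdot\|_r$ is the standard norm of $L^r(\Omega)$, $1\le r\le\infty$. $d_\Omega(x):=\inf_{y\in\partial\Omega}|x-y|$, $x\in\overline\Omega$, is the distance to the boundary. For $p>N$ and $1\le q<\infty$, $$\lambda_{p,q}:=\inf\{\|\nabla u\|_p^p: u\in W_0^{1,p}(\Omega),\ \|u\|_q=1\}.$$ The infimum is attained. A Sobolev extremal function corresponding to $\lambda_{p,q}$ is a positive minimizer $u_{p,q}$, i.e. $u_{p,q}\in W_0^{1,p}(\Omega)$, $u_{p,q}>0$ in $\Omega$, $\|u_{p,q}\|_q=1$ and $\|\nabla u_{p,q}\|_p^p=\lambda_{p,q}$ (it need not be unique when $q>p$; $u_{p,q(p)}$ denotes any choice). Functions in $W_0^{1,p}(\Omega)$, $p>N$, are identified with their continuous representatives on $\overline\Omega$. *)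

theory Defs
  imports "HOL-Analysis.Analysis"
begin

section \<open>Smooth functions and smooth domains\<close>

primrec k_times_cont_diff :: "nat \<Rightarrow> ('a::euclidean_space \<Rightarrow> real) \<Rightarrow> bool" where
  "k_times_cont_diff 0 f \<longleftrightarrow> continuous_on UNIV f"
| "k_times_cont_diff (Suc k) f \<longleftrightarrow>
     (\<forall>x. f differentiable (at x)) \<and>
     (\<forall>b\<in>Basis. k_times_cont_diff k (\<lambda>x. frechet_derivative f (at x) b))"

definition smooth_fun :: "('a::euclidean_space \<Rightarrow> real) \<Rightarrow> bool" where
  "smooth_fun f \<longleftrightarrow> (\<forall>k. k_times_cont_diff k f)"

text \<open>Near each of its points, the boundary is the graph of a smooth function over the hyperplane
  orthogonal to some unit vector \<open>\<nu>\<close>, and the set lies on one side of it. The function on the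
  hyperplane is given by a smooth function \<open>\<gamma>\<close> on the whole space, of which only the values on the
  hyperplane matter.\<close>

definition smooth_boundary :: "'a::euclidean_space set \<Rightarrow> bool" where
  "smooth_boundary \<Omega> \<longleftrightarrow>
     (\<forall>x0\<in>frontier \<Omega>. \<exists>e>0. \<exists>\<nu> \<gamma>. norm \<nu> = 1 \<and> smooth_fun \<gamma> \<and>
        \<Omega> \<inter> ball x0 e = {x \<in> ball x0 e. x \<bullet> \<nu> > \<gamma> (x - (x \<bullet> \<nu>) *\<^sub>R \<nu>)})"

definition bounded_smooth_domain :: "'a::euclidean_space set \<Rightarrow> bool" where
  "bounded_smooth_domain \<Omega> \<longleftrightarrow>
     \<Omega> \<noteq> {} \<and> open \<Omega> \<and> connected \<Omega> \<and> bounded \<Omega> \<and> smooth_boundary \<Omega>"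

section \<open>Lebesgue and Sobolev spaces\<close>

definition Lp_space :: "real \<Rightarrow> 'a::euclidean_space set \<Rightarrow> ('a \<Rightarrow> 'b::euclidean_space) set" where
  "Lp_space p \<Omega> = {f. f \<in> borel_measurable (lebesgue_on \<Omega>) \<and>
                      integrable (lebesgue_on \<Omega>) (\<lambda>x. norm (f x) powr p)}"

text \<open>Finite exponents only. The value is 0 for functions that are not in \<open>Lp_space p \<Omega>\<close>
  because their integral is not defined.\<close>

definition Lp_norm :: "real \<Rightarrow> 'a::euclidean_space set \<Rightarrow> ('a \<Rightarrow> 'b::euclidean_space) \<Rightarrow> real" where
  "Lp_norm p \<Omega> f =
     (if f \<in> Lp_space p \<Omega>
      then (\<integral>x. norm (f x) powr p \<partial>lebesgue_on \<Omega>) powr (1 / p) else 0)"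

definition test_functions :: "'a::euclidean_space set \<Rightarrow> ('a \<Rightarrow> real) set" where
  "test_functions \<Omega> =
     {\<phi>. smooth_fun \<phi> \<and> compact (closure {x. \<phi> x \<noteq> 0}) \<and> closure {x. \<phi> x \<noteq> 0} \<subseteq> \<Omega>}"

definition locally_integrable ::
    "'a::euclidean_space set \<Rightarrow> ('a \<Rightarrow> 'b::euclidean_space) \<Rightarrow> bool" where
  "locally_integrable \<Omega> f \<longleftrightarrow>
     (\<forall>K. compact K \<and> K \<subseteq> \<Omega> \<longrightarrow> integrable (lebesgue_on K) f)"

definition has_weak_gradient ::
    "'a::euclidean_space set \<Rightarrow> ('a \<Rightarrow> real) \<Rightarrow> ('a \<Rightarrow> 'a) \<Rightarrow> bool" where
  "has_weak_gradient \<Omega> u g \<longleftrightarrow>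
     locally_integrable \<Omega> u \<and> locally_integrable \<Omega> g \<and>
     (\<forall>\<phi>\<in>test_functions \<Omega>. \<forall>b\<in>Basis.
        (\<integral>x. u x * frechet_derivative \<phi> (at x) b \<partial>lebesgue_on \<Omega>) =
        - (\<integral>x. (g x \<bullet> b) * \<phi> x \<partial>lebesgue_on \<Omega>))"

text \<open>Weak gradients are unique up to null sets, so the choice below does not affect norms.\<close>

definition weak_gradient :: "'a::euclidean_space set \<Rightarrow> ('a \<Rightarrow> real) \<Rightarrow> 'a \<Rightarrow> 'a" where
  "weak_gradient \<Omega> u = (SOME g. has_weak_gradient \<Omega> u g)"

definition sobolev_space :: "real \<Rightarrow> 'a::euclidean_space set \<Rightarrow> ('a \<Rightarrow> real) set" where
  "sobolev_space p \<Omega> =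
     {u \<in> Lp_space p \<Omega>. \<exists>g\<in>Lp_space p \<Omega>. has_weak_gradient \<Omega> u g}"

definition sobolev_norm :: "real \<Rightarrow> 'a::euclidean_space set \<Rightarrow> ('a \<Rightarrow> real) \<Rightarrow> real" where
  "sobolev_norm p \<Omega> u =
     (Lp_norm p \<Omega> u powr p + Lp_norm p \<Omega> (weak_gradient \<Omega> u) powr p) powr (1 / p)"

text \<open>The closure of the test functions in \<open>sobolev_space p \<Omega>\<close>. Elements are functions rather than
  classes; the set is invariant under changes on null subsets of \<open>\<Omega>\<close> and arbitrary changes
  outside \<open>\<Omega>\<close>.\<close>

definition sobolev_space_0 :: "real \<Rightarrow> 'a::euclidean_space set \<Rightarrow> ('a \<Rightarrow> real) set" where
  "sobolev_space_0 p \<Omega> =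
     {u \<in> sobolev_space p \<Omega>. \<exists>\<phi>. (\<forall>k. \<phi> k \<in> test_functions \<Omega>) \<and>
        (\<lambda>k::nat. sobolev_norm p \<Omega> (\<lambda>x. u x - \<phi> k x)) \<longlonglongrightarrow> 0}"

section \<open>Sobolev constants and extremal functions\<close>

definition sobolev_const :: "'a::euclidean_space set \<Rightarrow> real \<Rightarrow> real \<Rightarrow> real" where
  "sobolev_const \<Omega> p q =
     Inf {Lp_norm p \<Omega> (weak_gradient \<Omega> u) powr p |u. u \<in> sobolev_space_0 p \<Omega> \<and> Lp_norm q \<Omega> u = 1}"

text \<open>Continuity on \<open>closure \<Omega>\<close> selects the continuous representative, which exists for
  \<open>p > DIM('a)\<close>.\<close>

definition sobolev_extremal ::
    "'a::euclidean_space set \<Rightarrow> real \<Rightarrow> real \<Rightarrow> ('a \<Rightarrow> real) \<Rightarrow> bool" where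
  "sobolev_extremal \<Omega> p q u \<longleftrightarrow>
     u \<in> sobolev_space_0 p \<Omega> \<and> continuous_on (closure \<Omega>) u \<and> (\<forall>x\<in>\<Omega>. u x > 0) \<and>
     Lp_norm q \<Omega> u = 1 \<and> Lp_norm p \<Omega> (weak_gradient \<Omega> u) powr p = sobolev_const \<Omega> p q"

definition boundary_dist :: "'a::euclidean_space set \<Rightarrow> 'a \<Rightarrow> real" where
  "boundary_dist \<Omega> x = infdist x (frontier \<Omega>)"

end

theory Submission
  imports Defs
begin

text \<open>Write \<open>d\<close> for the distance to the boundary and \<open>\<Lambda> p\<close> for the \<open>p\<close>-th root of the Sobolev
  constant. Mollifying \<open>max 0 (d - 2 / p)\<close> gives a test function with gradient at most 1, hence an
  upper bound for \<open>\<Lambda> p\<close> that tends to \<open>1 / \<parallel>d\<parallel>\<close>. Conversely, a Morrey estimate whose constant tends to 1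
  shows \<open>u p \<le> m p * (d + e p)\<close> with \<open>m p / \<Lambda> p \<longlonglongrightarrow> 1\<close> and \<open>e p \<longlonglongrightarrow> 0\<close>, and integrating the
  \<open>q p\<close>-th power gives the matching lower bound. Since both sides of this inequality have almost the
  same norm and \<open>u p\<close> is almost Lipschitz, a gap at one point would spread to a ball of fixed radius
  and make the norm of \<open>u p\<close> too small.\<close>

section \<open>Smooth functions\<close>

text \<open>No subsequence of the family \<open>u p\<close> is extracted: every estimate is explicit
  in \<open>p\<close>, so the limit of the constants is a sandwich. The obstacle is that the
  Lipschitz-type constant must converge to exactly 1, whereas a Morrey inequality with an
  unspecified constant would lose a factor. Averaging over cubes of half-side \<open>h\<close>
  separates two effects: the distance carries only the factor (2h)^(-N/p), and the price is an
  additive error proportional to h N. Taking h = 1/p sends the factor to 1 and the error to 0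
  simultaneously. The estimate is proved for functions extended by zero to the whole space, so
  segments may leave \<open>\<Omega>\<close> and a nearest boundary point can serve as second point;
  this is how \<open>d\<close> enters. Since \<open>weak_gradient\<close> is a choice and
  \<open>sobolev_space_0\<close> a closure, a large share of the work is the uniqueness of weak
  gradients and the passage from test functions to their limits. The exponent \<open>q p\<close>
  moves as well, so integrals of powers need dominated convergence with a varying exponent.\<close>

lemma differentiable_frechet_derivative_eq:
  assumes "\<And>x. (f has_derivative D x) (at x)"
  shows "f differentiable (at x)" "frechet_derivative f (at x) = D x"
  using assms frechet_derivative_at[OF assms] by (auto simp: differentiable_def)

lemma k_times_cont_diff_SucD: "k_times_cont_diff (Suc k) f \<Longrightarrow> k_times_cont_diff k f"
proof (induction k arbitrary: f)
  case 0
  then show ?case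
    by (auto intro!: differentiable_imp_continuous_on simp: differentiable_on_def)
next
  case (Suc k)
  then show ?case by auto
qed

lemma k_times_cont_diff_continuous: "k_times_cont_diff k f \<Longrightarrow> continuous_on UNIV f"
  by (induction k) (auto dest: k_times_cont_diff_SucD simp del: k_times_cont_diff.simps(2))

lemma k_times_cont_diff_const [simp]: "k_times_cont_diff k (\<lambda>x. c)"
  by (induction k arbitrary: c) auto

lemma k_times_cont_diff_inner: "k_times_cont_diff k (\<lambda>x. x \<bullet> c)"
proof (cases k)
  case (Suc n)
  have D: "((\<lambda>x. x \<bullet> c) has_derivative (\<lambda>h. h \<bullet> c)) (at x)" for x :: 'a
    by (auto intro!: derivative_eq_intros)
  have "(\<lambda>x. x \<bullet> c) differentiable at x"
      "frechet_derivative (\<lambda>x. x \<bullet> c) (at x) = (\<lambda>h. h \<bullet> c)" for x :: 'a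
    by (fact differentiable_frechet_derivative_eq[OF D])+
  then show ?thesis using Suc by simp
qed (auto intro!: continuous_intros)

lemma k_times_cont_diff_add:
  "k_times_cont_diff k f \<Longrightarrow> k_times_cont_diff k g \<Longrightarrow> k_times_cont_diff k (\<lambda>x. f x + g x)"
proof (induction k arbitrary: f g)
  case 0
  then show ?case by (auto intro!: continuous_intros)
next
  case (Suc k)
  have D: "((\<lambda>x. f x + g x) has_derivative
      (\<lambda>h. frechet_derivative f (at x) h + frechet_derivative g (at x) h)) (at x)" for x
    using Suc.prems by (intro has_derivative_add) (auto simp: frechet_derivative_works)
  have "(\<lambda>x. f x + g x) differentiable at x"
      "frechet_derivative (\<lambda>x. f x + g x) (at x) =
        (\<lambda>h. frechet_derivative f (at x) h + frechet_derivative g (at x) h)" for x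
    by (fact differentiable_frechet_derivative_eq[OF D])+
  then show ?case using Suc by simp
qed

lemma k_times_cont_diff_mult:
  "k_times_cont_diff k f \<Longrightarrow> k_times_cont_diff k g \<Longrightarrow> k_times_cont_diff k (\<lambda>x. f x * g x)"
proof (induction k arbitrary: f g)
  case 0
  then show ?case by (auto intro!: continuous_intros)
next
  case (Suc k)
  have D: "((\<lambda>x. f x * g x) has_derivative
      (\<lambda>h. f x * frechet_derivative g (at x) h + frechet_derivative f (at x) h * g x)) (at x)" for x
    using Suc.prems by (intro has_derivative_mult) (auto simp: frechet_derivative_works)
  have "(\<lambda>x. f x * g x) differentiable at x"
      "frechet_derivative (\<lambda>x. f x * g x) (at x) =
        (\<lambda>h. f x * frechet_derivative g (at x) h + frechet_derivative f (at x) h * g x)" for x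
    by (fact differentiable_frechet_derivative_eq[OF D])+
  \<comment> \<open>The product rule leaves undifferentiated factors, which must be available at
    order \<open>k\<close> for the induction hypothesis.\<close>
  moreover have "k_times_cont_diff k f" "k_times_cont_diff k g"
    using Suc.prems k_times_cont_diff_SucD by blast+
  ultimately show ?case using Suc by (simp add: k_times_cont_diff_add)
qed

lemma smooth_fun_const: "smooth_fun (\<lambda>x. c)"
  and smooth_fun_mult: "smooth_fun f \<Longrightarrow> smooth_fun g \<Longrightarrow> smooth_fun (\<lambda>x. f x * g x)"
  by (auto simp: smooth_fun_def k_times_cont_diff_mult)

text \<open>Built from the partial derivatives that \<open>k_times_cont_diff\<close> and
  \<open>has_weak_gradient\<close> mention, so that regularity and weak formulations transfer
  coordinate by coordinate.\<close>

definition grad :: "('a::euclidean_space \<Rightarrow> real) \<Rightarrow> 'a \<Rightarrow> 'a" where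
  "grad f x = (\<Sum>b\<in>Basis. frechet_derivative f (at x) b *\<^sub>R b)"

lemma k_times_cont_diff_has_derivative_grad:
  assumes "k_times_cont_diff (Suc k) f"
  shows "(f has_derivative (\<lambda>h. grad f x \<bullet> h)) (at x)"
proof -
  have d: "(f has_derivative frechet_derivative f (at x)) (at x)"
    using assms by (simp add: frechet_derivative_works)
  then interpret linear "frechet_derivative f (at x)"
    using has_derivative_linear by blast
  have "frechet_derivative f (at x) h = grad f x \<bullet> h" for h
  proof -
    have "frechet_derivative f (at x) (\<Sum>b\<in>Basis. (h \<bullet> b) *\<^sub>R b) = grad f x \<bullet> h"
      unfolding sum scale grad_def inner_sum_left
      by (intro sum.cong) (auto simp: inner_commute mult.commute)
    then show ?thesis by (simp add: euclidean_representation)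
  qed
  then show ?thesis using d by presburger
qed

lemma has_derivative_grad_unique:
  "(f has_derivative (\<lambda>h. g \<bullet> h)) (at x) \<Longrightarrow> grad f x = g"
  unfolding grad_def frechet_derivative_at[symmetric] by (simp add: euclidean_representation)

lemma k_times_cont_diff_continuous_grad:
  assumes "k_times_cont_diff (Suc k) f"
  shows "continuous_on UNIV (grad f)"
proof -
  have "continuous_on UNIV (\<lambda>x. frechet_derivative f (at x) b)" if "b \<in> Basis" for b
    using assms that by (intro k_times_cont_diff_continuous[where k = k]) auto
  then show ?thesis
    unfolding grad_def by (auto intro!: continuous_intros)
qed

lemma smooth_fun_has_derivative_grad:
    "smooth_fun f \<Longrightarrow> (f has_derivative (\<lambda>h. grad f x \<bullet> h)) (at x)"
  and smooth_fun_continuous_grad: "smooth_fun f \<Longrightarrow> continuous_on UNIV (grad f)"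
  and smooth_fun_continuous: "smooth_fun f \<Longrightarrow> continuous_on UNIV f"
  unfolding smooth_fun_def
  using k_times_cont_diff_has_derivative_grad k_times_cont_diff_continuous_grad
    k_times_cont_diff_continuous by blast+

lemma frechet_derivative_grad:
  "smooth_fun f \<Longrightarrow> frechet_derivative f (at x) h = grad f x \<bullet> h"
  using frechet_derivative_at[OF smooth_fun_has_derivative_grad] by metis

subsection \<open>A smooth bump function\<close>

text \<open>For \<open>m = 0\<close> this is Cauchy's flat function exp(-1/t). The extra powers of t
  make the family closed under differentiation up to linear combinations, so smoothness becomes one
  induction with \<open>m\<close> arbitrary.\<close>

definition flat_fun :: "nat \<Rightarrow> real \<Rightarrow> real" where
  "flat_fun m t = (if t > 0 then exp (- (1 / t)) / t ^ m else 0)"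

lemma flat_fun_tendsto_0: "(flat_fun m \<longlongrightarrow> 0) (at 0)"
proof -
  have "((\<lambda>t::real. inverse t ^ m / exp (inverse t)) \<longlongrightarrow> 0) (at_right 0)"
    by (rule filterlim_compose[OF tendsto_power_div_exp_0 filterlim_inverse_at_top_right])
  then have "(flat_fun m \<longlongrightarrow> 0) (at_right 0)"
    by (rule Lim_transform_eventually)
       (auto simp: flat_fun_def eventually_at_filter exp_minus field_simps)
  moreover have "(flat_fun m \<longlongrightarrow> 0) (at_left 0)"
    by (rule Lim_transform_eventually[OF tendsto_const])
       (auto simp: flat_fun_def eventually_at_filter)
  ultimately show ?thesis by (simp add: filterlim_split_at)
qed

lemma flat_fun_has_derivative:
  "(flat_fun m has_real_derivative flat_fun (m + 2) t - m * flat_fun (m + 1) t) (at t)"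
proof -
  consider "t > 0" | "t < 0" | "t = 0" by linarith
  then show ?thesis
  proof cases
    case 1
    have "((\<lambda>t. exp (- (1 / t)) / t ^ m) has_real_derivative
        (exp (- (1 / t)) * (1 / t\<^sup>2) * t ^ m - exp (- (1 / t)) * (m * t ^ (m - 1))) / (t ^ m * t ^ m))
        (at t)"
      using 1 by (auto intro!: derivative_eq_intros simp: power2_eq_square field_simps)
    also have "(exp (- (1 / t)) * (1 / t\<^sup>2) * t ^ m - exp (- (1 / t)) * (m * t ^ (m - 1))) / (t ^ m * t ^ m)
        = flat_fun (m + 2) t - m * flat_fun (m + 1) t"
      using 1 by (cases m) (auto simp: flat_fun_def field_simps power2_eq_square)
    finally show ?thesis
      by (rule has_field_derivative_transform_within_open[where S = "{0<..}"])
         (use 1 in \<open>auto simp: flat_fun_def\<close>)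
  next
    case 2
    have "((\<lambda>t. 0) has_real_derivative flat_fun (m + 2) t - m * flat_fun (m + 1) t) (at t)"
      using 2 by (simp add: flat_fun_def)
    then show ?thesis
      by (rule has_field_derivative_transform_within_open[where S = "{..<0}"])
         (use 2 in \<open>auto simp: flat_fun_def\<close>)
  next
    case 3
    \<comment> \<open>At the origin the difference quotient of \<open>flat_fun m\<close> is itself
      \<open>flat_fun (m + 1)\<close>, whose limit is known.\<close>
    have "((\<lambda>h. (flat_fun m (0 + h) - flat_fun m 0) / h) \<longlongrightarrow> 0) (at 0)"
      by (rule Lim_transform_eventually[OF flat_fun_tendsto_0[of "m + 1"]])
         (auto simp: flat_fun_def eventually_at_filter field_simps)
    then show ?thesis using 3 by (simp add: DERIV_def flat_fun_def)
  qed
qed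

text \<open>A partial derivative is a linear function times functions of the same shape with larger
  \<open>m\<close>, hence the induction hypothesis for all \<open>m\<close>.\<close>

lemma k_times_cont_diff_flat_fun:
  "k_times_cont_diff k (\<lambda>x. flat_fun m (c - x \<bullet> x))"
proof (induction k arbitrary: m)
  case 0
  have "continuous_on UNIV (flat_fun m)"
    by (intro continuous_at_imp_continuous_on ballI DERIV_isCont[OF flat_fun_has_derivative])
  then show ?case
    by (auto intro!: continuous_on_compose2[of UNIV "flat_fun m"] continuous_intros)
next
  case (Suc k)
  let ?g = "\<lambda>t. flat_fun (m + 2) t + (- real m) * flat_fun (m + 1) t"
  have D: "((\<lambda>x. flat_fun m (c - x \<bullet> x)) has_derivative
      (\<lambda>h. - (2 * (x \<bullet> h)) * ?g (c - x \<bullet> x))) (at x)" for x :: 'a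
  proof -
    have "((\<lambda>x. c - x \<bullet> x) has_derivative (\<lambda>h. - (2 * (x \<bullet> h)))) (at x)"
      by (auto intro!: derivative_eq_intros simp: inner_commute)
    from DERIV_compose_FDERIV[OF flat_fun_has_derivative this, of m] show ?thesis
      by simp
  qed
  have "(\<lambda>x. flat_fun m (c - x \<bullet> x)) differentiable at x"
      "frechet_derivative (\<lambda>x. flat_fun m (c - x \<bullet> x)) (at x) =
        (\<lambda>h. - (2 * (x \<bullet> h)) * ?g (c - x \<bullet> x))" for x :: 'a
    by (fact differentiable_frechet_derivative_eq[OF D])+
  moreover have "k_times_cont_diff k (\<lambda>x. (- 2) * (x \<bullet> b) * ?g (c - x \<bullet> x))" for b :: 'a
    by (intro k_times_cont_diff_mult k_times_cont_diff_add k_times_cont_diff_const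
        k_times_cont_diff_inner Suc)
  ultimately show ?case by simp
qed

section \<open>Continuous functions with compact support\<close>

text \<open>Bridges three integrals: differentiation under the integral sign is done with the gauge
  integral on boxes, changes of variables with \<open>lborel\<close>, and norms with
  \<open>lebesgue_on\<close>. For continuous functions of compact support all agree.\<close>

lemma
  fixes f :: "'a::euclidean_space \<Rightarrow> 'b::euclidean_space"
  assumes "continuous_on UNIV f" and "compact K" and "\<And>x. f x \<noteq> 0 \<Longrightarrow> x \<in> K"
  shows integrable_compact_support: "integrable lborel f"
    and integrable_lebesgue_on_compact_support:
      "S \<in> sets lebesgue \<Longrightarrow> integrable (lebesgue_on S) f"
    and integral_lebesgue_on_compact_support:
      "S \<in> sets lebesgue \<Longrightarrow> (\<And>x. f x \<noteq> 0 \<Longrightarrow> x \<in> S) \<Longrightarrow>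
        integral\<^sup>L (lebesgue_on S) f = integral\<^sup>L lborel f"
    and integral_cbox_compact_support:
      "(\<And>x. f x \<noteq> 0 \<Longrightarrow> x \<in> cbox a b) \<Longrightarrow> integral (cbox a b) f = integral\<^sup>L lborel f"
proof -
  have "(\<lambda>x. indicator K x *\<^sub>R f x) = f"
    by (rule ext) (use assms(3) in \<open>auto simp: indicator_def\<close>)
  then show lb: "integrable lborel f"
    using borel_integrable_compact[of K f] assms continuous_on_subset[of UNIV f K] by auto
  have m: "f \<in> borel_measurable lborel"
    using lb by auto
  have c: "integrable lebesgue f" "integral\<^sup>L lebesgue f = integral\<^sup>L lborel f"
    using lb m by (auto simp: integrable_completion integral_completion)
  show "integrable (lebesgue_on S) f" if "S \<in> sets lebesgue"
    using that c by (auto simp: integrable_restrict_space intro!: integrable_mult_indicator)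
  show "integral\<^sup>L (lebesgue_on S) f = integral\<^sup>L lborel f"
    if "S \<in> sets lebesgue" "\<And>x. f x \<noteq> 0 \<Longrightarrow> x \<in> S"
  proof -
    have "(\<lambda>x. indicator S x *\<^sub>R f x) = f"
      by (rule ext) (use that(2) in \<open>auto simp: indicator_def\<close>)
    then show ?thesis using that c by (simp add: integral_restrict_space)
  qed
  show "integral (cbox a b) f = integral\<^sup>L lborel f"
    if "\<And>x. f x \<noteq> 0 \<Longrightarrow> x \<in> cbox a b"
  proof -
    have "integral UNIV (\<lambda>x. if x \<in> cbox a b then f x else 0) = integral\<^sup>L lborel f"
      using that by (subst integral_lborel[OF lb, symmetric]) (metis (full_types))
    then show ?thesis by (simp only: integral_restrict_UNIV)
  qed
qed

text \<open>Serves three substitutions: reflection (\<open>c = -1\<close>) for convolutions,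
  translation (\<open>c = 1\<close>) for integrals of gradients, and dilation for shrinking
  cubes.\<close>

lemma
  fixes f :: "'a::euclidean_space \<Rightarrow> 'b::{banach, second_countable_topology}"
  assumes "integrable lborel f" "c \<noteq> 0"
  shows lborel_integrable_affine: "integrable lborel (\<lambda>x. f (t + c *\<^sub>R x))"
    and lborel_integral_affine:
      "(\<integral>x. f (t + c *\<^sub>R x) \<partial>lborel) = (\<integral>x. f x \<partial>lborel) /\<^sub>R \<bar>c\<bar> ^ DIM('a)"
proof -
  have m: "f \<in> borel_measurable borel"
    using assms by auto
  have i: "integrable (density (distr lborel borel (\<lambda>x. t + c *\<^sub>R x)) (\<lambda>_. ennreal (\<bar>c\<bar> ^ DIM('a)))) f"
    using assms lborel_affine[OF assms(2), of t] by (simp add: ennreal_power)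
  then have "integrable lborel (\<lambda>x. \<bar>c\<bar> ^ DIM('a) *\<^sub>R f (t + c *\<^sub>R x))"
    using m by (auto simp: integrable_density integrable_distr_eq)
  then have "integrable lborel (\<lambda>x. inverse (\<bar>c\<bar> ^ DIM('a)) *\<^sub>R \<bar>c\<bar> ^ DIM('a) *\<^sub>R f (t + c *\<^sub>R x))"
    by (rule integrable_scaleR_right)
  then show "integrable lborel (\<lambda>x. f (t + c *\<^sub>R x))"
    using assms(2) by simp
  have "(\<integral>x. f x \<partial>lborel) =
      (\<integral>x. f x \<partial>density (distr lborel borel (\<lambda>x. t + c *\<^sub>R x)) (\<lambda>_. ennreal (\<bar>c\<bar> ^ DIM('a))))"
    using lborel_affine[OF assms(2), of t] by (simp add: ennreal_power)
  also have "\<dots> = \<bar>c\<bar> ^ DIM('a) *\<^sub>R (\<integral>x. f (t + c *\<^sub>R x) \<partial>lborel)"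
    using m by (simp add: integral_density integral_distr)
  finally show "(\<integral>x. f (t + c *\<^sub>R x) \<partial>lborel) = (\<integral>x. f x \<partial>lborel) /\<^sub>R \<bar>c\<bar> ^ DIM('a)"
    using assms(2) by simp
qed

subsection \<open>Mollification\<close>

lemma smooth_mollifier_exists:
  assumes "\<delta> > 0"
  obtains \<eta> :: "'a::euclidean_space \<Rightarrow> real" where "smooth_fun \<eta>" "\<And>x. \<eta> x \<ge> 0"
    "\<And>x. norm x \<ge> \<delta> \<Longrightarrow> \<eta> x = 0" "integral\<^sup>L lborel \<eta> = 1"
proof -
  define \<psi> :: "'a \<Rightarrow> real" where "\<psi> x = flat_fun 0 (\<delta>\<^sup>2 - x \<bullet> x)" for x
  have s: "smooth_fun \<psi>"
    unfolding \<psi>_def smooth_fun_def by (simp add: k_times_cont_diff_flat_fun)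
  have nn: "\<psi> x \<ge> 0" for x
    by (simp add: \<psi>_def flat_fun_def)
  have z: "\<psi> x = 0" if "norm x \<ge> \<delta>" for x
    using that assms power_mono[OF that, of 2]
    by (simp add: \<psi>_def flat_fun_def power2_norm_eq_inner)
  have supp: "x \<in> cball 0 \<delta>" if "\<psi> x \<noteq> 0" for x
    using z[of x] that by fastforce
  obtain a where a: "cball (0::'a) \<delta> \<subseteq> cbox (-a) a"
    using bounded_subset_cbox_symmetric[OF bounded_cball] by blast
  \<comment> \<open>A nonnegative continuous function with zero integral over a box vanishes on it,
    but the bump is positive at the origin.\<close>
  have "integral\<^sup>L lborel \<psi> \<noteq> 0"
  proof
    assume "integral\<^sup>L lborel \<psi> = 0"
    moreover have "integral (cbox (-a) a) \<psi> = integral\<^sup>L lborel \<psi>"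
      using a supp by (intro integral_cbox_compact_support[OF _ compact_cball[of 0 \<delta>]] smooth_fun_continuous s) auto
    ultimately have "(\<psi> has_integral 0) (cbox (-a) a)"
      using integrable_integral[OF integrable_continuous]
        continuous_on_subset[OF smooth_fun_continuous[OF s]] by (metis subset_UNIV)
    moreover have "0 \<in> ball (0::'a) \<delta>" using assms by simp
    then have "0 \<in> interior (cbox (-a) a)"
      using a by (meson ball_subset_cball interiorI open_ball subset_trans)
    then have "box (-a) a \<noteq> {}" "0 \<in> cbox (-a) a"
      by (auto simp: interior_cbox box_subset_cbox[THEN subsetD])
    ultimately have "\<psi> 0 = 0"
      using has_integral_0_cbox_imp_0[of "-a" a \<psi> 0] nn
        continuous_on_subset[OF smooth_fun_continuous[OF s]] by auto
    then show False using assms by (simp add: \<psi>_def flat_fun_def)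
  qed
  moreover have "integral\<^sup>L lborel \<psi> \<ge> 0"
    using nn by (rule integral_nonneg_AE[OF AE_I2])
  ultimately have pos: "integral\<^sup>L lborel \<psi> > 0" by simp
  show ?thesis
  proof (rule that[of "\<lambda>x. inverse (integral\<^sup>L lborel \<psi>) * \<psi> x"])
    show "smooth_fun (\<lambda>x. inverse (integral\<^sup>L lborel \<psi>) * \<psi> x)"
      by (intro smooth_fun_mult smooth_fun_const s)
  qed (use pos nn z in auto)
qed

text \<open>All derivatives fall on the kernel: a partial derivative of the convolution is the
  convolution with a partial derivative of \<open>\<eta>\<close>, so the induction generalises over
  \<open>\<eta>\<close> while \<open>f\<close> is merely continuous.\<close>

lemma k_times_cont_diff_convolution:
  assumes "continuous_on UNIV f" "k_times_cont_diff k \<eta>"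
  shows "k_times_cont_diff k (\<lambda>x. integral (cbox a b) (\<lambda>y. f y * \<eta> (x - y)))"
  using assms(2)
proof (induction k arbitrary: \<eta>)
  case 0
  then show ?case
    by (auto intro!: integral_continuous_on_param continuous_on_compose2[of UNIV \<eta>]
        continuous_on_compose2[OF assms(1)] continuous_intros simp: split_beta)
next
  case (Suc k)
  have c0: "continuous_on UNIV \<eta>"
    using k_times_cont_diff_continuous[OF Suc.prems] .
  have cg: "continuous_on UNIV (grad \<eta>)"
    using k_times_cont_diff_continuous_grad[OF Suc.prems] .
  \<comment> \<open>\<open>leibniz_rule\<close> asks for a derivative that is continuous as a
    bounded linear operator, hence the packaging of the gradient by
    \<open>blinfun_inner_left\<close>.\<close>
  have "((\<lambda>x. integral (cbox a b) (\<lambda>y. f y * \<eta> (x - y))) has_derivative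
      integral (cbox a b) (\<lambda>y. blinfun_inner_left (f y *\<^sub>R grad \<eta> (x - y)))) (at x within UNIV)" for x
  proof (rule leibniz_rule)
    fix x y :: 'a
    have "((\<lambda>x. \<eta> (x - y)) has_derivative (\<lambda>h. grad \<eta> (x - y) \<bullet> h)) (at x)"
      by (rule has_derivative_compose[OF _ k_times_cont_diff_has_derivative_grad[OF Suc.prems],
            of "\<lambda>x. x - y" "\<lambda>h. h", simplified])
         (auto intro!: derivative_eq_intros)
    then show "((\<lambda>x. f y * \<eta> (x - y)) has_derivative
        blinfun_apply (blinfun_inner_left (f y *\<^sub>R grad \<eta> (x - y)))) (at x within UNIV)"
      by (auto intro!: derivative_eq_intros simp: blinfun_inner_left.rep_eq inner_commute)
  next
    fix x :: 'a
    show "(\<lambda>y. f y * \<eta> (x - y)) integrable_on cbox a b"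
      by (auto intro!: integrable_continuous continuous_on_compose2[OF c0]
          continuous_on_compose2[OF assms(1)] continuous_intros)
  next
    show "continuous_on (UNIV \<times> cbox a b)
        (\<lambda>(x, y). blinfun_inner_left (f y *\<^sub>R grad \<eta> (x - y)))"
      by (auto intro!: continuous_on_compose2[OF cg] bounded_linear.continuous_on[OF bounded_linear_blinfun_inner_left]
          continuous_on_compose2[OF assms(1)] continuous_intros simp: split_beta)
  qed auto
  moreover have "blinfun_apply (integral (cbox a b) (\<lambda>y. blinfun_inner_left (f y *\<^sub>R grad \<eta> (x - y)))) h
      = integral (cbox a b) (\<lambda>y. f y * frechet_derivative \<eta> (at (x - y)) h)" for x h
  proof -
    have "(\<lambda>y. blinfun_inner_left (f y *\<^sub>R grad \<eta> (x - y))) integrable_on cbox a b"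
      by (auto intro!: integrable_continuous continuous_on_compose2[OF cg]
          bounded_linear.continuous_on[OF bounded_linear_blinfun_inner_left]
          continuous_on_compose2[OF assms(1)] continuous_intros)
    then have "blinfun_apply (integral (cbox a b) (\<lambda>y. blinfun_inner_left (f y *\<^sub>R grad \<eta> (x - y)))) h
      = integral (cbox a b) (\<lambda>y. blinfun_apply (blinfun_inner_left (f y *\<^sub>R grad \<eta> (x - y))) h)"
      by (rule blinfun_apply_integral)
    then show ?thesis
      using frechet_derivative_at[OF k_times_cont_diff_has_derivative_grad[OF Suc.prems], symmetric]
      by (simp add: blinfun_inner_left.rep_eq inner_commute)
  qed
  ultimately have D: "((\<lambda>x. integral (cbox a b) (\<lambda>y. f y * \<eta> (x - y))) has_derivative
      (\<lambda>h. integral (cbox a b) (\<lambda>y. f y * frechet_derivative \<eta> (at (x - y)) h))) (at x)" for x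
    by (metis (no_types, lifting) has_derivative_eq_rhs ext)
  have "k_times_cont_diff k (\<lambda>x. integral (cbox a b) (\<lambda>y. f y * frechet_derivative \<eta> (at (x - y)) c))"
    if "c \<in> Basis" for c
    using Suc.IH[of "\<lambda>x. frechet_derivative \<eta> (at x) c"] Suc.prems that by simp
  then show ?case
    by (simp add: differentiable_frechet_derivative_eq[OF D])
qed

text \<open>The four conclusions are averages of the corresponding facts for translates of
  \<open>f\<close> against a probability density supported in the ball of radius
  \<open>\<delta>\<close>. Preserving the Lipschitz constant without loss is what makes the upper
  bound for the Sobolev constant sharp.\<close>

lemma mollification_exists:
  fixes f :: "'a::euclidean_space \<Rightarrow> real"
  assumes f: "continuous_on UNIV f" "compact K" "\<And>x. f x \<noteq> 0 \<Longrightarrow> x \<in> K" and "\<delta> > 0"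
  obtains g where "smooth_fun g"
    "\<And>x. g x \<noteq> 0 \<Longrightarrow> \<exists>y. f y \<noteq> 0 \<and> dist x y < \<delta>"
    "\<And>x e. (\<And>y. dist x y < \<delta> \<Longrightarrow> \<bar>f y - f x\<bar> \<le> e) \<Longrightarrow> \<bar>g x - f x\<bar> \<le> e"
    "\<And>L x y. (\<And>x y. \<bar>f x - f y\<bar> \<le> L * dist x y) \<Longrightarrow> \<bar>g x - g y\<bar> \<le> L * dist x y"
proof -
  obtain \<eta> :: "'a \<Rightarrow> real" where \<eta>: "smooth_fun \<eta>" "\<And>x. \<eta> x \<ge> 0"
    "\<And>x. norm x \<ge> \<delta> \<Longrightarrow> \<eta> x = 0" "integral\<^sup>L lborel \<eta> = 1"
    using smooth_mollifier_exists \<open>\<delta> > 0\<close> by blast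
  have c\<eta>: "continuous_on UNIV \<eta>"
    using smooth_fun_continuous[OF \<eta>(1)] .
  obtain a where a: "K \<subseteq> cbox (-a) a"
    using bounded_subset_cbox_symmetric[OF compact_imp_bounded] f by blast
  define g where "g x = integral (cbox (-a) a) (\<lambda>y. f y * \<eta> (x - y))" for x
  have supp: "y \<in> cball 0 \<delta>" if "\<eta> y \<noteq> 0" for y
    using \<eta>(3)[of y] that by fastforce
  have int: "integrable lborel (\<lambda>z. f (x - z) * \<eta> z)" for x
    using supp
    by (intro integrable_compact_support[of _ "cball 0 \<delta>"])
       (auto intro!: continuous_on_compose2[OF f(1)] continuous_on_compose2[OF c\<eta>] continuous_intros)
  have int\<eta>: "integrable lborel \<eta>"
    using supp c\<eta> by (intro integrable_compact_support[of _ "cball 0 \<delta>"]) auto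
  \<comment> \<open>Reflecting moves the dependence on \<open>x\<close> from the kernel to
    \<open>f\<close>, so that values at different points are compared under the same
    density.\<close>
  have g: "g x = (\<integral>z. f (x - z) * \<eta> z \<partial>lborel)" for x
  proof -
    have "g x = (\<integral>y. f y * \<eta> (x - y) \<partial>lborel)"
      unfolding g_def using a f(3)
      by (intro integral_cbox_compact_support[OF _ f(2)])
         (auto intro!: continuous_on_compose2[OF f(1)] continuous_on_compose2[OF c\<eta>] continuous_intros)
    also have "\<dots> = (\<integral>z. f (x - z) * \<eta> z \<partial>lborel)"
      using lborel_integral_affine[of "\<lambda>z. f (x - z) * \<eta> z" "-1" x] int by simp
    finally show ?thesis .
  qed
  show ?thesis
  proof (rule that)
    show "smooth_fun g"
      using \<eta>(1) f(1) unfolding g_def smooth_fun_def by (auto intro: k_times_cont_diff_convolution)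
    show "\<exists>y. f y \<noteq> 0 \<and> dist x y < \<delta>" if "g x \<noteq> 0" for x
    proof (rule ccontr)
      assume *: "\<not> ?thesis"
      have "f (x - z) * \<eta> z = 0" for z
        using * \<eta>(3)[of z] by (auto simp: dist_norm dest!: spec[of _ "x - z"])
      then have "g x = 0"
        unfolding g by (intro integral_eq_zero_AE AE_I2)
      then show False using that by simp
    qed
    show "\<bar>g x - f x\<bar> \<le> e" if e: "\<And>y. dist x y < \<delta> \<Longrightarrow> \<bar>f y - f x\<bar> \<le> e" for x e
    proof -
      have "g x - f x = (\<integral>z. f (x - z) * \<eta> z - f x * \<eta> z \<partial>lborel)"
        using int int\<eta> \<eta>(4) by (simp add: g)
      also have "\<bar>\<dots>\<bar> \<le> (\<integral>z. e * \<eta> z \<partial>lborel)"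
      proof (rule order_trans[OF integral_abs_bound], rule integral_mono)
        show "\<bar>f (x - z) * \<eta> z - f x * \<eta> z\<bar> \<le> e * \<eta> z" for z
        proof (cases "norm z < \<delta>")
          case True
          then have "\<bar>f (x - z) - f x\<bar> * \<eta> z \<le> e * \<eta> z"
            by (intro mult_right_mono e \<eta>) (simp add: dist_norm)
          then show ?thesis
            using \<eta>(2)[of z] by (simp add: left_diff_distrib[symmetric] abs_mult)
        qed (simp add: \<eta>)
      qed (use int int\<eta> in auto)
      finally show ?thesis using \<eta>(4) by simp
    qed
    show "\<bar>g x - g y\<bar> \<le> L * dist x y" if L: "\<And>x y. \<bar>f x - f y\<bar> \<le> L * dist x y" for L x y
    proof -
      have "g x - g y = (\<integral>z. f (x - z) * \<eta> z - f (y - z) * \<eta> z \<partial>lborel)"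
        using int by (simp add: g)
      also have "\<bar>\<dots>\<bar> \<le> (\<integral>z. L * dist x y * \<eta> z \<partial>lborel)"
      proof (rule order_trans[OF integral_abs_bound], rule integral_mono)
        show "\<bar>f (x - z) * \<eta> z - f (y - z) * \<eta> z\<bar> \<le> L * dist x y * \<eta> z" for z
          using mult_right_mono[OF L[of "x - z" "y - z"] \<eta>(2)[of z]] \<eta>(2)[of z]
          by (simp add: left_diff_distrib[symmetric] abs_mult dist_norm)
      qed (use int int\<eta> in auto)
      finally show ?thesis using \<eta>(4) by simp
    qed
  qed
qed

section \<open>Uniqueness of weak gradients\<close>

lemma compact_in_sets_lebesgue: "compact K \<Longrightarrow> K \<in> sets lebesgue"
  for K :: "'a::euclidean_space set"
  by (simp add: fmeasurableD lmeasurable_compact)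

lemma locally_integrable_mult_integrable:
  fixes h f :: "'a::euclidean_space \<Rightarrow> real"
  assumes "open \<Omega>" "locally_integrable \<Omega> h" "continuous_on UNIV f"
    "compact K" "K \<subseteq> \<Omega>" "\<And>x. f x \<noteq> 0 \<Longrightarrow> x \<in> K"
  shows "integrable (lebesgue_on \<Omega>) (\<lambda>x. h x * f x)"
    and "integral\<^sup>L (lebesgue_on \<Omega>) (\<lambda>x. h x * f x) = integral\<^sup>L (lebesgue_on K) (\<lambda>x. h x * f x)"
proof -
  have K: "K \<in> sets lebesgue" "\<Omega> \<in> sets lebesgue"
    using assms by (auto simp: compact_in_sets_lebesgue)
  have h: "integrable (lebesgue_on K) h"
    using assms by (auto simp: locally_integrable_def)
  have "compact (f ` K)"
    using assms continuous_on_subset compact_continuous_image by blast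
  then obtain B where B: "\<And>x. x \<in> K \<Longrightarrow> \<bar>f x\<bar> \<le> B"
    using compact_imp_bounded bounded_real by (metis imageI)
  have f: "f \<in> borel_measurable (lebesgue_on K)"
    using continuous_on_subset[OF assms(3), of K] K
    by (intro continuous_imp_measurable_on_sets_lebesgue) auto
  have "integrable (lebesgue_on K) (\<lambda>x. h x * f x)"
  proof (rule Bochner_Integration.integrable_bound)
    show "integrable (lebesgue_on K) (\<lambda>x. B * h x)" using h by simp
    show "(\<lambda>x. h x * f x) \<in> borel_measurable (lebesgue_on K)"
      using f h by (intro borel_measurable_times) auto
    have "\<bar>h x\<bar> * \<bar>f x\<bar> \<le> \<bar>B\<bar> * \<bar>h x\<bar>" if "x \<in> K" for x
      using B[OF that] by (subst mult.commute) (auto intro: mult_right_mono)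
    then show "AE x in lebesgue_on K. norm (h x * f x) \<le> norm (B * h x)"
      by (auto simp: abs_mult)
  qed
  moreover have eq: "(\<lambda>x. indicator K x *\<^sub>R (h x * f x)) = (\<lambda>x. indicator \<Omega> x *\<^sub>R (h x * f x))"
    by (rule ext) (use assms in \<open>auto simp: indicator_def\<close>)
  ultimately show "integrable (lebesgue_on \<Omega>) (\<lambda>x. h x * f x)"
    using K by (simp add: integrable_restrict_space)
  show "integral\<^sup>L (lebesgue_on \<Omega>) (\<lambda>x. h x * f x) = integral\<^sup>L (lebesgue_on K) (\<lambda>x. h x * f x)"
    using K eq by (simp add: integral_restrict_space)
qed

text \<open>Heine-Cantor on the unit neighbourhood of \<open>K\<close>: two points closer than 1
  either both lie there or both are zeros of \<open>f\<close>.\<close>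

lemma compact_support_uniformly_continuous:
  fixes f :: "'a::euclidean_space \<Rightarrow> real"
  assumes "continuous_on UNIV f" "compact K" "\<And>x. f x \<noteq> 0 \<Longrightarrow> x \<in> K" "e > 0"
  obtains \<delta> where "\<delta> > 0" "\<And>x y. dist x y < \<delta> \<Longrightarrow> \<bar>f x - f y\<bar> < e"
proof -
  let ?K = "\<Union>x\<in>K. cball x 1"
  have "uniformly_continuous_on ?K f"
    using assms compact_minkowski_sum_cball continuous_on_subset
    by (intro compact_uniformly_continuous) blast+
  then obtain \<delta> where \<delta>: "\<delta> > 0" "\<And>x y. x \<in> ?K \<Longrightarrow> y \<in> ?K \<Longrightarrow> dist y x < \<delta> \<Longrightarrow> dist (f y) (f x) < e"
    using \<open>e > 0\<close> unfolding uniformly_continuous_on_def by metis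
  have "\<bar>f x - f y\<bar> < e" if d: "dist x y < min \<delta> 1" for x y
  proof (cases "f x = 0 \<and> f y = 0")
    case False
    then have "x \<in> K \<or> y \<in> K" using assms(3) by blast
    then have "x \<in> ?K" "y \<in> ?K"
      using d by (auto simp: dist_commute less_imp_le intro: bexI[of _ x] bexI[of _ y])
    then show ?thesis using \<delta>(2)[of y x] d by (simp add: dist_real_def)
  qed (use \<open>e > 0\<close> in simp)
  then show ?thesis using that[of "min \<delta> 1"] \<delta>(1) by auto
qed

lemma test_functionsI:
  assumes "smooth_fun g" "compact K" "K \<subseteq> \<Omega>" "\<And>x. g x \<noteq> 0 \<Longrightarrow> x \<in> K"
  shows "g \<in> test_functions \<Omega>"
proof -
  have "closure {x. g x \<noteq> 0} \<subseteq> K"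
    using assms by (intro closure_minimal compact_imp_closed) auto
  then show ?thesis
    using assms compact_closure bounded_subset[OF compact_imp_bounded[OF \<open>compact K\<close>]]
    unfolding test_functions_def by (metis (mono_tags, lifting) closure_subset mem_Collect_eq subset_trans)
qed

text \<open>A mollification of \<open>f\<close> is a test function uniformly within \<open>e\<close>
  of \<open>f\<close> and supported in one compact neighbourhood \<open>K'\<close>, so the error is
  at most \<open>e\<close> times the integral of \<open>\<bar>h\<bar>\<close> over
  \<open>K'\<close>.\<close>

lemma integral_mult_eq_0_of_test_functions:
  fixes h f :: "'a::euclidean_space \<Rightarrow> real"
  assumes "open \<Omega>" "locally_integrable \<Omega> h"
    "\<And>\<psi>. \<psi> \<in> test_functions \<Omega> \<Longrightarrow> (\<integral>x. h x * \<psi> x \<partial>lebesgue_on \<Omega>) = 0"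
    and f: "continuous_on UNIV f" "compact K" "K \<subseteq> \<Omega>" "\<And>x. f x \<noteq> 0 \<Longrightarrow> x \<in> K"
  shows "(\<integral>x. h x * f x \<partial>lebesgue_on \<Omega>) = 0"
proof -
  obtain \<delta>0 where \<delta>0: "\<delta>0 > 0" "(\<Union>x\<in>K. cball x \<delta>0) \<subseteq> \<Omega>"
    using compact_subset_open_imp_cball_epsilon_subset assms by blast
  define K' where "K' = (\<Union>x\<in>K. cball x \<delta>0)"
  have K': "compact K'" "K' \<subseteq> \<Omega>" "K \<subseteq> K'"
    using \<delta>0 compact_minkowski_sum_cball[OF f(2)] by (force simp: K'_def)+
  have h: "integrable (lebesgue_on K') h"
    using assms(2) K' by (auto simp: locally_integrable_def)
  have *: "\<bar>\<integral>x. h x * f x \<partial>lebesgue_on \<Omega>\<bar> \<le> e * (\<integral>x. \<bar>h x\<bar> \<partial>lebesgue_on K')" if "e > 0" for e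
  proof -
    obtain \<delta> where \<delta>: "\<delta> > 0" "\<And>x y. dist x y < \<delta> \<Longrightarrow> \<bar>f x - f y\<bar> < e"
      using compact_support_uniformly_continuous[OF f(1,2,4) \<open>e > 0\<close>] by metis
    obtain g where g: "smooth_fun g"
      "\<And>x. g x \<noteq> 0 \<Longrightarrow> \<exists>y. f y \<noteq> 0 \<and> dist x y < min \<delta> \<delta>0"
      "\<And>x e. (\<And>y. dist x y < min \<delta> \<delta>0 \<Longrightarrow> \<bar>f y - f x\<bar> \<le> e) \<Longrightarrow> \<bar>g x - f x\<bar> \<le> e"
      using mollification_exists[OF f(1,2,4), of "min \<delta> \<delta>0"] \<delta> \<delta>0 by (metis min_less_iff_conj)
    have gK: "x \<in> K'" if gx: "g x \<noteq> 0" for x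
    proof -
      obtain y where "f y \<noteq> 0" "dist x y < min \<delta> \<delta>0" using g(2)[OF gx] by blast
      then show ?thesis using f(4)[of y] by (auto simp: K'_def dist_commute intro!: bexI[of _ y])
    qed
    have fg: "\<bar>g x - f x\<bar> \<le> e" for x
      using \<delta>(2)[of _ x] by (intro g(3)) (auto simp: dist_commute less_imp_le)
    note ih = locally_integrable_mult_integrable[OF assms(1,2) _ K'(1,2)]
    have i1: "integrable (lebesgue_on \<Omega>) (\<lambda>x. h x * f x)"
      using f K' by (intro ih) auto
    have i2: "integrable (lebesgue_on \<Omega>) (\<lambda>x. h x * g x)"
      using g(1) gK by (intro ih) (auto simp: smooth_fun_continuous)
    have fgK: "x \<in> K'" if "f x - g x \<noteq> 0" for x
      using that f(4)[of x] gK[of x] K'(3) by (cases "f x = 0") auto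
    have cd: "continuous_on UNIV (\<lambda>x. f x - g x)"
      using f(1) smooth_fun_continuous[OF g(1)] by (intro continuous_intros)
    have "(\<integral>x. h x * g x \<partial>lebesgue_on \<Omega>) = 0"
      using test_functionsI[OF g(1) K'(1,2) gK] by (rule assms(3))
    then have "(\<integral>x. h x * f x \<partial>lebesgue_on \<Omega>) = (\<integral>x. h x * (f x - g x) \<partial>lebesgue_on \<Omega>)"
      using i1 i2 by (simp add: right_diff_distrib)
    also have "\<dots> = (\<integral>x. h x * (f x - g x) \<partial>lebesgue_on K')"
      by (intro ih cd fgK)
    also have "\<bar>\<dots>\<bar> \<le> (\<integral>x. e * \<bar>h x\<bar> \<partial>lebesgue_on K')"
    proof (rule integral_abs_bound_integral)
      have "integrable (lebesgue_on \<Omega>) (\<lambda>x. h x * (f x - g x))"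
        using i1 i2 by (simp add: right_diff_distrib)
      moreover have "(\<lambda>x. indicator K' x *\<^sub>R (h x * (f x - g x))) = (\<lambda>x. indicator \<Omega> x *\<^sub>R (h x * (f x - g x)))"
        by (rule ext) (use fgK K' in \<open>auto simp: indicator_def\<close>)
      ultimately show "integrable (lebesgue_on K') (\<lambda>x. h x * (f x - g x))"
        using K' assms(1) by (simp add: integrable_restrict_space compact_in_sets_lebesgue)
      show "\<bar>h x * (f x - g x)\<bar> \<le> e * \<bar>h x\<bar>" for x
        using mult_right_mono[OF fg[of x], of "\<bar>h x\<bar>"]
        by (simp add: abs_mult abs_minus_commute mult.commute)
    qed (use h in auto)
    finally show ?thesis by simp
  qed
  have "((\<lambda>e. e * (\<integral>x. \<bar>h x\<bar> \<partial>lebesgue_on K')) \<longlongrightarrow> 0 * (\<integral>x. \<bar>h x\<bar> \<partial>lebesgue_on K')) (at_right 0)"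
    by (intro tendsto_intros)
  then have "\<bar>\<integral>x. h x * f x \<partial>lebesgue_on \<Omega>\<bar> \<le> 0 * (\<integral>x. \<bar>h x\<bar> \<partial>lebesgue_on K')"
    by (rule tendsto_lowerbound) (use * in \<open>auto simp: eventually_at_filter\<close>)
  then show ?thesis by simp
qed

lemma integral_compact_eq_0_of_test_functions:
  fixes h :: "'a::euclidean_space \<Rightarrow> real"
  assumes "open \<Omega>" "locally_integrable \<Omega> h"
    "\<And>\<psi>. \<psi> \<in> test_functions \<Omega> \<Longrightarrow> (\<integral>x. h x * \<psi> x \<partial>lebesgue_on \<Omega>) = 0"
    and C: "compact C" "C \<subseteq> \<Omega>"
  shows "(\<integral>x. h x \<partial>lebesgue_on C) = 0"
\<comment> \<open>The empty set is set apart because \<open>infdist\<close> to it is 0, which would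
  make the cutoffs below identically 1.\<close>
proof (cases "C = {}")
  case False
  obtain \<delta> where \<delta>: "\<delta> > 0" "(\<Union>x\<in>C. cball x \<delta>) \<subseteq> \<Omega>"
    using compact_subset_open_imp_cball_epsilon_subset assms by blast
  define K where "K = (\<Union>x\<in>C. cball x \<delta>)"
  have K: "compact K" "K \<subseteq> \<Omega>" "C \<subseteq> K"
    using \<delta> compact_minkowski_sum_cball[OF C(1)] by (force simp: K_def)+
  have h: "integrable (lebesgue_on K) h"
    using assms(2) K by (auto simp: locally_integrable_def)
  \<comment> \<open>Cutoffs equal to 1 on \<open>C\<close> and, for positive \<open>n\<close>,
    vanishing at distance \<open>\<delta>\<close> / n; they converge to the indicator of
    \<open>C\<close>. The index \<open>Suc n\<close> is used throughout because \<open>f 0\<close>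
    is constantly 1.\<close>
  define f where "f n x = max 0 (1 - real n / \<delta> * infdist x C)" for n x
  have f1: "continuous_on UNIV (f n)" for n
    unfolding f_def by (intro continuous_intros)
  have f2: "x \<in> K" if "f (Suc n) x \<noteq> 0" for x n
  proof -
    have "infdist x C / \<delta> * 1 \<le> infdist x C / \<delta> * real (Suc n)"
      using \<delta>(1) by (intro mult_left_mono) (auto simp: infdist_nonneg)
    then have "infdist x C < \<delta>"
      using that \<delta>(1) by (auto simp: f_def max_def field_simps split: if_splits)
    moreover obtain y where "y \<in> C" "infdist x C = dist x y"
      using infdist_attains_inf[OF compact_imp_closed[OF C(1)] False] by blast
    ultimately show ?thesis by (auto simp: K_def dist_commute intro!: bexI[of _ y])
  qed
  have "(\<lambda>n. \<integral>x. h x * f (Suc n) x \<partial>lebesgue_on K) \<longlonglongrightarrow> (\<integral>x. indicator C x *\<^sub>R h x \<partial>lebesgue_on K)"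
  proof (rule integral_dominated_convergence[where w = "\<lambda>x. \<bar>h x\<bar>"])
    have CK: "C \<in> sets (lebesgue_on K)"
      using C K by (simp add: sets_restrict_space_iff compact_in_sets_lebesgue)
    then show "(\<lambda>x. indicator C x *\<^sub>R h x) \<in> borel_measurable (lebesgue_on K)"
      using h by (intro borel_measurable_scaleR) auto
    have "f n \<in> borel_measurable (lebesgue_on K)" for n
      using K continuous_on_subset[OF f1[of n], of K]
      by (intro continuous_imp_measurable_on_sets_lebesgue compact_in_sets_lebesgue) auto
    then show "(\<lambda>x. h x * f (Suc n) x) \<in> borel_measurable (lebesgue_on K)" for n
      using h by (intro borel_measurable_times) auto
    have "(\<lambda>n. h x * f (Suc n) x) \<longlonglongrightarrow> indicator C x *\<^sub>R h x" for x
    proof (cases "x \<in> C")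
      case True
      then show ?thesis by (simp add: f_def)
    next
      case False
      then have pos: "infdist x C / \<delta> > 0"
        using C(1) \<open>C \<noteq> {}\<close> \<delta>(1) in_closed_iff_infdist_zero[OF compact_imp_closed[OF C(1)]] infdist_nonneg[of x C]
        by (auto simp: order_less_le)
      obtain N where N: "real N * (infdist x C / \<delta>) > 1"
        using reals_Archimedean3[OF pos] by blast
      have "f (Suc n) x = 0" if "n \<ge> N" for n
      proof -
        have "real N * (infdist x C / \<delta>) \<le> real (Suc n) * (infdist x C / \<delta>)"
          using that pos by (intro mult_right_mono) auto
        then show ?thesis using N by (simp add: f_def)
      qed
      then have "\<forall>\<^sub>F n in sequentially. h x * f (Suc n) x = 0"
        by (auto simp: eventually_sequentially)
      then show ?thesis using False by (simp add: tendsto_eventually)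
    qed
    then show "AE x in lebesgue_on K. (\<lambda>n. h x * f (Suc n) x) \<longlonglongrightarrow> indicator C x *\<^sub>R h x"
      by simp
    have "f n x \<le> 1" "f n x \<ge> 0" for n x
      using \<delta>(1) by (auto simp: f_def infdist_nonneg)
    then show "AE x in lebesgue_on K. norm (h x * f (Suc n) x) \<le> \<bar>h x\<bar>" for n
      by (auto simp: abs_mult mult_left_le)
  qed (use h in auto)
  moreover have "(\<integral>x. h x * f (Suc n) x \<partial>lebesgue_on K) = 0" for n
    using integral_mult_eq_0_of_test_functions[OF assms(1-3) f1[of "Suc n"] K(1,2) f2]
      locally_integrable_mult_integrable(2)[OF assms(1,2) f1[of "Suc n"] K(1,2) f2] by simp
  ultimately have "(\<integral>x. indicator C x *\<^sub>R h x \<partial>lebesgue_on K) = 0"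
    by (simp add: LIMSEQ_const_iff)
  moreover have "(\<lambda>x. indicator K x *\<^sub>R (indicator C x *\<^sub>R h x)) = (\<lambda>x. indicator C x *\<^sub>R h x)"
    by (rule ext) (use K in \<open>auto simp: indicator_def\<close>)
  ultimately show ?thesis
    using C K by (simp add: integral_restrict_space compact_in_sets_lebesgue)
qed simp

text \<open>Inner regularity: a positivity set of positive measure would contain a compact subset of
  positive measure, on which a strictly positive function cannot have integral 0.\<close>

lemma negligible_pos_set:
  fixes h :: "'a::euclidean_space \<Rightarrow> real"
  assumes "integrable (lebesgue_on K) h" "compact K"
    and 0: "\<And>C. compact C \<Longrightarrow> C \<subseteq> K \<Longrightarrow> (\<integral>x. h x \<partial>lebesgue_on C) = 0"
  shows "negligible {x \<in> K. h x > 0}" (is "negligible ?A")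
proof -
  have "{x \<in> space (lebesgue_on K). h x > 0} \<in> sets (lebesgue_on K)"
    using assms(1) by measurable
  then have A: "?A \<in> sets lebesgue"
    using assms(2) by (simp add: sets_restrict_space_iff compact_in_sets_lebesgue)
  have "emeasure lebesgue ?A = 0"
  proof (rule ccontr)
    assume ne: "emeasure lebesgue ?A \<noteq> 0"
    have "?A \<in> lmeasurable"
      using A assms(2) by (intro bounded_set_imp_lmeasurable) (auto intro: bounded_subset compact_imp_bounded)
    then have fin: "emeasure lebesgue ?A = ennreal (measure lebesgue ?A)" "measure lebesgue ?A > 0"
      using ne by (auto simp: emeasure_eq_measure2 zero_less_measure_iff fmeasurableD2 emeasure_eq_ennreal_measure)
    \<comment> \<open>With the measure of the whole set as tolerance, the part left over is strictly
      smaller than the set, which is all that forces \<open>T\<close> to be non-null.\<close>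
    obtain T where T: "closed T" "T \<subseteq> ?A" "?A - T \<in> lmeasurable"
      "emeasure lebesgue (?A - T) < emeasure lebesgue ?A"
      using sets_lebesgue_inner_closed[OF A fin(2)] unfolding fin(1) .
    have cT: "compact T"
      using T bounded_subset[OF compact_imp_bounded[OF assms(2)], of T]
      by (auto simp: compact_eq_bounded_closed)
    have Ts: "T \<in> sets lebesgue" using cT by (rule compact_in_sets_lebesgue)
    have i: "integrable (lebesgue_on T) h"
    proof -
      have "integrable lebesgue (\<lambda>x. indicator K x *\<^sub>R h x)"
        using assms(1,2) integrable_restrict_space[of K lebesgue h]
        by (simp add: compact_in_sets_lebesgue)
      then have "integrable lebesgue (\<lambda>x. indicator T x *\<^sub>R indicator K x *\<^sub>R h x)"
        by (rule integrable_mult_indicator[OF Ts])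
      moreover have "(\<lambda>x. indicator T x *\<^sub>R indicator K x *\<^sub>R h x) = (\<lambda>x. indicator T x *\<^sub>R h x)"
        by (rule ext) (use T in \<open>auto simp: indicator_def\<close>)
      ultimately show ?thesis using Ts by (simp add: integrable_restrict_space)
    qed
    have "(\<integral>x. h x \<partial>lebesgue_on T) = 0"
      using T cT by (intro 0) auto
    moreover have pos: "AE x in lebesgue_on T. 0 < h x"
      using T by (intro AE_I2) auto
    moreover have "AE x in lebesgue_on T. 0 \<le> h x"
      using pos by eventually_elim simp
    ultimately have "AE x in lebesgue_on T. h x = 0"
      using integral_nonneg_eq_0_iff_AE[OF i] by simp
    with pos have "AE x in lebesgue_on T. False"
      by eventually_elim simp
    then have "emeasure (lebesgue_on T) (space (lebesgue_on T)) = 0"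
      using AE_iff_measurable[of "space (lebesgue_on T)" "lebesgue_on T" "\<lambda>x. False"] by simp
    then have "emeasure lebesgue T = 0"
      using Ts by (simp add: emeasure_restrict_space)
    then have "emeasure lebesgue (?A - T) = emeasure lebesgue ?A"
      using A Ts by (intro emeasure_Diff_null_set null_setsI)
    then show False using T(4) by simp
  qed
  then show ?thesis using A by (simp add: negligible_iff_emeasure0)
qed

text \<open>The fundamental lemma of the calculus of variations, obtained on each member of a
  compact exhaustion by applying the sign argument to \<open>h\<close> and to
  \<open>- h\<close>.\<close>

lemma AE_eq_0_of_test_functions:
  fixes h :: "'a::euclidean_space \<Rightarrow> real"
  assumes "open \<Omega>" "locally_integrable \<Omega> h"
    "\<And>\<psi>. \<psi> \<in> test_functions \<Omega> \<Longrightarrow> (\<integral>x. h x * \<psi> x \<partial>lebesgue_on \<Omega>) = 0"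
  shows "negligible {x \<in> \<Omega>. h x \<noteq> 0}"
proof (rule open_Union_compact_subsets[OF assms(1)])
  fix C :: "nat \<Rightarrow> 'a set"
  assume C: "\<And>n. compact (C n)" "\<And>n. C n \<subseteq> \<Omega>" "\<Union>(range C) = \<Omega>"
  have "negligible ({x \<in> C n. h x > 0} \<union> {x \<in> C n. - h x > 0})" for n
  proof (rule negligible_Un)
    have i: "integrable (lebesgue_on (C n)) h"
      using assms(2) C(1,2) by (auto simp: locally_integrable_def)
    have z: "(\<integral>x. h x \<partial>lebesgue_on K) = 0" if "compact K" "K \<subseteq> C n" for K
      using that C(2)[of n] by (intro integral_compact_eq_0_of_test_functions[OF assms]) auto
    show "negligible {x \<in> C n. h x > 0}"
      by (rule negligible_pos_set[OF i C(1) z])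
    show "negligible {x \<in> C n. - h x > 0}"
      by (rule negligible_pos_set[OF _ C(1)]) (use i z in auto)
  qed
  then have "negligible (\<Union>n. {x \<in> C n. h x > 0} \<union> {x \<in> C n. - h x > 0})"
    by (intro negligible_countable_Union countable_image) auto
  moreover have "{x \<in> \<Omega>. h x \<noteq> 0} \<subseteq> (\<Union>n. {x \<in> C n. h x > 0} \<union> {x \<in> C n. - h x > 0})"
  proof
    fix x assume "x \<in> {x \<in> \<Omega>. h x \<noteq> 0}"
    then obtain n where "x \<in> C n" "h x \<noteq> 0" using C(3) by blast
    then show "x \<in> (\<Union>n. {x \<in> C n. h x > 0} \<union> {x \<in> C n. - h x > 0})"
      by (intro UN_I[of n]) auto
  qed
  ultimately show ?thesis by (rule negligible_subset)
qed

section \<open>Weak gradients\<close>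

lemma test_functionsD:
  assumes "\<phi> \<in> test_functions \<Omega>"
  obtains K where "smooth_fun \<phi>" "compact K" "K \<subseteq> \<Omega>" "\<And>x. \<phi> x \<noteq> 0 \<Longrightarrow> x \<in> K"
    "\<And>x. grad \<phi> x \<noteq> 0 \<Longrightarrow> x \<in> K"
proof -
  let ?K = "closure {x. \<phi> x \<noteq> 0}"
  have K: "smooth_fun \<phi>" "compact ?K" "?K \<subseteq> \<Omega>"
    using assms by (auto simp: test_functions_def)
  have 0: "x \<in> ?K" if "\<phi> x \<noteq> 0" for x
    using that closure_subset by fastforce
  have "x \<in> ?K" if "grad \<phi> x \<noteq> 0" for x
  proof (rule ccontr)
    assume "x \<notin> ?K"
    moreover have "((\<lambda>x. 0) has_derivative (\<lambda>h. 0 \<bullet> h)) (at x)"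
      by (auto intro!: derivative_eq_intros)
    ultimately have "(\<phi> has_derivative (\<lambda>h. 0 \<bullet> h)) (at x)"
      using 0 by (elim has_derivative_transform_within_open[OF _ open_Compl[OF closed_closure]]) auto
    then show False using that has_derivative_grad_unique by blast
  qed
  then show ?thesis using that K 0 by blast
qed

text \<open>Stated with general \<open>\<alpha>\<close> and \<open>\<beta>\<close> to cover both a
  translated family (constant \<open>\<beta>\<close>) and a cube dilated about a point (constant
  \<open>\<alpha>\<close>, \<open>\<beta>\<close> the identity).\<close>

lemma has_derivative_integral_along_segments:
  fixes f :: "'a::euclidean_space \<Rightarrow> real" and \<alpha> \<beta> :: "'b::euclidean_space \<Rightarrow> 'a"
  assumes "smooth_fun f" "continuous_on UNIV \<alpha>" "continuous_on UNIV \<beta>"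
  shows "((\<lambda>t. integral (cbox a b) (\<lambda>z. f (\<alpha> z + t *\<^sub>R \<beta> z))) has_real_derivative
    integral (cbox a b) (\<lambda>z. grad f (\<alpha> z + t *\<^sub>R \<beta> z) \<bullet> \<beta> z)) (at t)"
proof -
  note c = continuous_on_compose2[OF smooth_fun_continuous[OF assms(1)]]
    continuous_on_compose2[OF smooth_fun_continuous_grad[OF assms(1)]]
    continuous_on_compose2[OF assms(2)] continuous_on_compose2[OF assms(3)]
  have "((\<lambda>t. f (\<alpha> z + t *\<^sub>R \<beta> z)) has_real_derivative grad f (\<alpha> z + t *\<^sub>R \<beta> z) \<bullet> \<beta> z) (at t)" for z t
  proof -
    have "((\<lambda>t. \<alpha> z + t *\<^sub>R \<beta> z) has_derivative (\<lambda>h. h *\<^sub>R \<beta> z)) (at t)"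
      by (auto intro!: derivative_eq_intros)
    from has_derivative_compose[OF this smooth_fun_has_derivative_grad[OF assms(1)]]
    show ?thesis by (simp add: has_field_derivative_def mult_commute_abs)
  qed
  then have "((\<lambda>t. integral (cbox a b) (\<lambda>z. f (\<alpha> z + t *\<^sub>R \<beta> z))) has_real_derivative
    integral (cbox a b) (\<lambda>z. grad f (\<alpha> z + t *\<^sub>R \<beta> z) \<bullet> \<beta> z)) (at t within UNIV)"
    by (intro leibniz_rule_field_derivative)
       (auto intro!: integrable_continuous continuous_intros c simp: split_beta)
  then show ?thesis by simp
qed

text \<open>Translation does not change the integral of \<open>w\<close>; differentiating the
  integral of the translates by t c at t = 0 therefore gives 0.\<close>

lemma integral_grad_compact_support:
  fixes w :: "'a::euclidean_space \<Rightarrow> real"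
  assumes "w \<in> test_functions UNIV"
  shows "(\<integral>x. grad w x \<bullet> c \<partial>lborel) = 0"
proof -
  obtain K where K: "smooth_fun w" "compact K" "\<And>x. w x \<noteq> 0 \<Longrightarrow> x \<in> K"
    "\<And>x. grad w x \<noteq> 0 \<Longrightarrow> x \<in> K"
    using test_functionsD[OF assms] by metis
  \<comment> \<open>Padding by \<open>norm c\<close> keeps the supports of all translates with
    \<bar>t\<bar> < 1 in one compact set, hence in one box.\<close>
  let ?K = "\<Union>x\<in>K. cball x (norm c)"
  have cK: "compact ?K" "K \<subseteq> ?K"
    using K(2) compact_minkowski_sum_cball by auto
  obtain a where a: "?K \<subseteq> cbox (-a) a"
    using bounded_subset_cbox_symmetric[OF compact_imp_bounded[OF cK(1)]] by blast
  let ?F = "\<lambda>t. integral (cbox (-a) a) (\<lambda>z. w (z + t *\<^sub>R c))"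
  have cw: "continuous_on UNIV w" using smooth_fun_continuous[OF K(1)] .
  have F: "?F t = integral\<^sup>L lborel w" if t: "t \<in> {-1<..<1}" for t
  proof -
    have "?F t = (\<integral>z. w (z + t *\<^sub>R c) \<partial>lborel)"
    proof (rule integral_cbox_compact_support[OF _ cK(1)])
      show "continuous_on UNIV (\<lambda>z. w (z + t *\<^sub>R c))"
        by (intro continuous_on_compose2[OF cw] continuous_intros) auto
      show *: "z \<in> ?K" if "w (z + t *\<^sub>R c) \<noteq> 0" for z
        using K(3)[OF that] t mult_right_mono[of "\<bar>t\<bar>" 1 "norm c"]
        by (intro UN_I[of "z + t *\<^sub>R c"]) (auto simp: dist_norm)
      show "z \<in> cbox (-a) a" if "w (z + t *\<^sub>R c) \<noteq> 0" for z
        using *[OF that] a by blast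
    qed
    also have "\<dots> = integral\<^sup>L lborel w"
      using lborel_integral_affine[of w 1 "t *\<^sub>R c"] integrable_compact_support[OF cw K(2,3)]
      by (simp add: add.commute)
    finally show ?thesis .
  qed
  have "(?F has_real_derivative integral (cbox (-a) a) (\<lambda>z. grad w (z + 0 *\<^sub>R c) \<bullet> c)) (at 0)"
    by (intro has_derivative_integral_along_segments K continuous_intros)
  moreover have "(?F has_real_derivative 0) (at 0)"
    by (rule has_field_derivative_transform_within_open[OF DERIV_const[of "integral\<^sup>L lborel w"],
          where S = "{-1<..<1}"]) (auto simp: F)
  ultimately have "integral (cbox (-a) a) (\<lambda>z. grad w z \<bullet> c) = 0"
    using DERIV_unique by fastforce
  moreover have "integral (cbox (-a) a) (\<lambda>z. grad w z \<bullet> c) = (\<integral>x. grad w x \<bullet> c \<partial>lborel)"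
  proof (rule integral_cbox_compact_support[OF _ cK(1)])
    show "continuous_on UNIV (\<lambda>z. grad w z \<bullet> c)"
      by (intro continuous_intros smooth_fun_continuous_grad K)
    show *: "z \<in> ?K" if "grad w z \<bullet> c \<noteq> 0" for z
    proof -
      have "z \<in> K" using that K(4)[of z] by (cases "grad w z = 0") auto
      then show ?thesis using cK(2) by blast
    qed
    show "z \<in> cbox (-a) a" if "grad w z \<bullet> c \<noteq> 0" for z
      using *[OF that] a by blast
  qed
  ultimately show ?thesis by simp
qed

lemma grad_mult:
  assumes "smooth_fun f" "smooth_fun g"
  shows "grad (\<lambda>x. f x * g x) x = f x *\<^sub>R grad g x + g x *\<^sub>R grad f x"
proof (rule has_derivative_grad_unique)
  show "((\<lambda>x. f x * g x) has_derivative (\<lambda>h. (f x *\<^sub>R grad g x + g x *\<^sub>R grad f x) \<bullet> h)) (at x)"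
    using has_derivative_mult[OF assms[THEN smooth_fun_has_derivative_grad]]
    by (simp add: inner_add_left mult.commute add.commute)
qed

lemma grad_cmult: "smooth_fun f \<Longrightarrow> grad (\<lambda>x. c * f x) x = c *\<^sub>R grad f x"
  using smooth_fun_has_derivative_grad[of f x]
  by (intro has_derivative_grad_unique) (auto intro!: derivative_eq_intros)

lemma test_function_cmult:
  assumes "\<phi> \<in> test_functions \<Omega>" shows "(\<lambda>x. c * \<phi> x) \<in> test_functions \<Omega>"
proof -
  obtain K where "smooth_fun \<phi>" "compact K" "K \<subseteq> \<Omega>" "\<And>x. \<phi> x \<noteq> 0 \<Longrightarrow> x \<in> K"
    using test_functionsD[OF assms] by metis
  then show ?thesis
    by (intro test_functionsI[of _ K]) (auto intro: smooth_fun_mult smooth_fun_const)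
qed

text \<open>Integration by parts without boundary term: the gradient of the compactly supported
  product of \<open>\<phi>\<close> and \<open>\<psi>\<close> integrates to 0.\<close>

lemma test_function_has_weak_gradient:
  fixes \<phi> :: "'a::euclidean_space \<Rightarrow> real"
  assumes "open \<Omega>" "\<phi> \<in> test_functions \<Omega>"
  shows "has_weak_gradient \<Omega> \<phi> (grad \<phi>)"
proof -
  obtain K where K: "smooth_fun \<phi>" "compact K" "K \<subseteq> \<Omega>" "\<And>x. \<phi> x \<noteq> 0 \<Longrightarrow> x \<in> K"
    "\<And>x. grad \<phi> x \<noteq> 0 \<Longrightarrow> x \<in> K"
    using test_functionsD[OF assms(2)] by metis
  have c: "continuous_on UNIV \<phi>" "continuous_on UNIV (grad \<phi>)"
    using smooth_fun_continuous[OF K(1)] smooth_fun_continuous_grad[OF K(1)] .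
  have "(\<integral>x. \<phi> x * frechet_derivative \<psi> (at x) b \<partial>lebesgue_on \<Omega>) =
      - (\<integral>x. (grad \<phi> x \<bullet> b) * \<psi> x \<partial>lebesgue_on \<Omega>)" if \<psi>: "\<psi> \<in> test_functions \<Omega>" for \<psi> b
  proof -
    have s: "smooth_fun \<psi>" using \<psi> by (auto simp: test_functions_def)
    have c': "continuous_on UNIV \<psi>" "continuous_on UNIV (grad \<psi>)"
      using smooth_fun_continuous[OF s] smooth_fun_continuous_grad[OF s] .
    have K': "x \<in> K" if "\<phi> x * (grad \<psi> x \<bullet> b) \<noteq> 0" for x using that K by auto
    have K'': "x \<in> K" if "(grad \<phi> x \<bullet> b) * \<psi> x \<noteq> 0" for x
      using that K(5)[of x] by (cases "grad \<phi> x = 0") auto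
    have cc: "continuous_on UNIV (\<lambda>x. \<phi> x * (grad \<psi> x \<bullet> b))"
        "continuous_on UNIV (\<lambda>x. (grad \<phi> x \<bullet> b) * \<psi> x)"
      by (intro continuous_intros c c')+
    have "(\<lambda>x. \<phi> x * \<psi> x) \<in> test_functions UNIV"
      using K s by (intro test_functionsI[of _ K] smooth_fun_mult) auto
    then have "0 = (\<integral>x. grad (\<lambda>x. \<phi> x * \<psi> x) x \<bullet> b \<partial>lborel)"
      by (simp add: integral_grad_compact_support)
    also have "\<dots> = (\<integral>x. \<phi> x * (grad \<psi> x \<bullet> b) + (grad \<phi> x \<bullet> b) * \<psi> x \<partial>lborel)"
      by (simp add: grad_mult[OF K(1) s] inner_add_left mult.commute)
    also have "\<dots> = (\<integral>x. \<phi> x * (grad \<psi> x \<bullet> b) \<partial>lborel) + (\<integral>x. (grad \<phi> x \<bullet> b) * \<psi> x \<partial>lborel)"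
      using integrable_compact_support[OF cc(1) K(2) K'] integrable_compact_support[OF cc(2) K(2) K'']
      by simp
    also have "(\<integral>x. \<phi> x * (grad \<psi> x \<bullet> b) \<partial>lborel) = (\<integral>x. \<phi> x * (grad \<psi> x \<bullet> b) \<partial>lebesgue_on \<Omega>)"
      using assms(1) K' K(3) by (intro integral_lebesgue_on_compact_support[symmetric, OF cc(1) K(2)]) auto
    also have "(\<integral>x. (grad \<phi> x \<bullet> b) * \<psi> x \<partial>lborel) = (\<integral>x. (grad \<phi> x \<bullet> b) * \<psi> x \<partial>lebesgue_on \<Omega>)"
      using assms(1) K'' K(3) by (intro integral_lebesgue_on_compact_support[symmetric, OF cc(2) K(2)]) auto
    finally show ?thesis by (simp add: frechet_derivative_grad[OF s])
  qed
  moreover have "locally_integrable \<Omega> \<phi>" "locally_integrable \<Omega> (grad \<phi>)"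
    using c K unfolding locally_integrable_def
    by (auto intro!: integrable_lebesgue_on_compact_support[of _ K] compact_in_sets_lebesgue)
  ultimately show ?thesis by (auto simp: has_weak_gradient_def)
qed

lemma has_weak_gradient_test_integrable:
  assumes "open \<Omega>" "has_weak_gradient \<Omega> u g" "\<psi> \<in> test_functions \<Omega>"
  shows "integrable (lebesgue_on \<Omega>) (\<lambda>x. u x * frechet_derivative \<psi> (at x) b)"
    and "integrable (lebesgue_on \<Omega>) (\<lambda>x. (g x \<bullet> b) * \<psi> x)"
proof -
  obtain K where K: "smooth_fun \<psi>" "compact K" "K \<subseteq> \<Omega>" "\<And>x. \<psi> x \<noteq> 0 \<Longrightarrow> x \<in> K"
    "\<And>x. grad \<psi> x \<noteq> 0 \<Longrightarrow> x \<in> K"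
    using test_functionsD[OF assms(3)] by metis
  have l: "locally_integrable \<Omega> u" "locally_integrable \<Omega> (\<lambda>x. g x \<bullet> b)"
    using assms(2) by (auto simp: has_weak_gradient_def locally_integrable_def)
  have "x \<in> K" if "frechet_derivative \<psi> (at x) b \<noteq> 0" for x
    using that K(5)[of x] by (cases "grad \<psi> x = 0") (auto simp: frechet_derivative_grad[OF K(1)])
  moreover have "continuous_on UNIV (\<lambda>x. frechet_derivative \<psi> (at x) b)"
    unfolding frechet_derivative_grad[OF K(1)]
    by (intro continuous_intros smooth_fun_continuous_grad K)
  ultimately show "integrable (lebesgue_on \<Omega>) (\<lambda>x. u x * frechet_derivative \<psi> (at x) b)"
    by (intro locally_integrable_mult_integrable[OF assms(1) l(1) _ K(2,3)])
  show "integrable (lebesgue_on \<Omega>) (\<lambda>x. (g x \<bullet> b) * \<psi> x)"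
    by (intro locally_integrable_mult_integrable[OF assms(1) l(2) _ K(2,3,4)] smooth_fun_continuous K)
qed

lemma has_weak_gradient_diff:
  assumes "open \<Omega>" "has_weak_gradient \<Omega> u g" "has_weak_gradient \<Omega> v k"
  shows "has_weak_gradient \<Omega> (\<lambda>x. u x - v x) (\<lambda>x. g x - k x)"
  using assms(2,3) has_weak_gradient_test_integrable[OF assms(1,2)]
    has_weak_gradient_test_integrable[OF assms(1,3)]
  unfolding has_weak_gradient_def
  by (simp add: locally_integrable_def left_diff_distrib inner_diff_left)

text \<open>The difference of the two gradients, tested coordinate by coordinate, satisfies the
  fundamental lemma; finitely many null sets are then united.\<close>

lemma has_weak_gradient_unique:
  fixes u :: "'a::euclidean_space \<Rightarrow> real"
  assumes "open \<Omega>" "has_weak_gradient \<Omega> u g" "has_weak_gradient \<Omega> u k"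
  shows "AE x in lebesgue_on \<Omega>. g x = k x"
proof -
  have "negligible {x \<in> \<Omega>. (g x - k x) \<bullet> b \<noteq> 0}" if b: "b \<in> Basis" for b
  proof (rule AE_eq_0_of_test_functions[OF assms(1)])
    show "locally_integrable \<Omega> (\<lambda>x. (g x - k x) \<bullet> b)"
      using assms(2,3) by (auto simp: has_weak_gradient_def locally_integrable_def)
    show "(\<integral>x. (g x - k x) \<bullet> b * \<psi> x \<partial>lebesgue_on \<Omega>) = 0" if "\<psi> \<in> test_functions \<Omega>" for \<psi>
      using has_weak_gradient_test_integrable(2)[OF assms(1,2) that]
        has_weak_gradient_test_integrable(2)[OF assms(1,3) that] assms(2,3) b that
      by (simp add: has_weak_gradient_def inner_diff_left left_diff_distrib)
  qed
  then have "negligible (\<Union>b\<in>Basis. {x \<in> \<Omega>. (g x - k x) \<bullet> b \<noteq> 0})"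
    by (intro negligible_countable_Union countable_image countable_finite) auto
  then have "negligible {x \<in> \<Omega>. g x \<noteq> k x}"
    by (rule negligible_subset) (auto simp: euclidean_eq_iff[of "g _"] inner_diff_left)
  then have "{x \<in> \<Omega>. g x \<noteq> k x} \<in> null_sets lebesgue"
    by (simp add: negligible_iff_null_sets)
  then have "AE x in lebesgue. x \<in> \<Omega> \<longrightarrow> g x = k x"
    by (rule AE_I') auto
  then show ?thesis using assms(1) by (simp add: AE_restrict_space_iff)
qed

lemma weak_gradient_AE_eq:
  fixes u :: "'a::euclidean_space \<Rightarrow> real"
  assumes "open \<Omega>" "has_weak_gradient \<Omega> u g"
  shows "AE x in lebesgue_on \<Omega>. weak_gradient \<Omega> u x = g x"
  using has_weak_gradient_unique[OF assms(1) _ assms(2)] someI[of "has_weak_gradient \<Omega> u", OF assms(2)]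
  unfolding weak_gradient_def .

text \<open>Congruence of integrals up to null sets requires measurability on all of
  \<open>\<Omega>\<close>; it is glued from a countable compact exhaustion.\<close>

lemma locally_integrable_measurable:
  fixes g :: "'a::euclidean_space \<Rightarrow> 'b::euclidean_space"
  assumes "open \<Omega>" "locally_integrable \<Omega> g"
  shows "g \<in> borel_measurable (lebesgue_on \<Omega>)"
proof (rule open_Union_compact_subsets[OF assms(1)])
  fix C :: "nat \<Rightarrow> 'a set"
  assume C: "\<And>n. compact (C n)" "\<And>n. C n \<subseteq> \<Omega>" "\<Union>(range C) = \<Omega>"
  show ?thesis
  proof (rule measurable_piecewise_restrict2)
    show "C n \<in> sets (lebesgue_on \<Omega>)" for n
      using C assms(1) by (simp add: sets_restrict_space_iff compact_in_sets_lebesgue)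
    show "space (lebesgue_on \<Omega>) = (\<Union>n. C n)" using C by simp
    have "(\<lambda>x. indicator (C n) x *\<^sub>R g x) \<in> borel_measurable (lebesgue_on \<Omega>)" for n
    proof -
      have "integrable (lebesgue_on (C n)) g"
        using assms(2) C by (auto simp: locally_integrable_def)
      then have "integrable lebesgue (\<lambda>x. indicator (C n) x *\<^sub>R g x)"
        using integrable_restrict_space[of "C n" lebesgue g] C by (simp add: compact_in_sets_lebesgue)
      then show ?thesis by (intro measurable_restrict_space1) auto
    qed
    then show "\<exists>h\<in>borel_measurable (lebesgue_on \<Omega>). \<forall>x\<in>C n. g x = h x" for n
      by (intro bexI[of _ "\<lambda>x. indicator (C n) x *\<^sub>R g x"]) auto
  qed
qed

text \<open>Allows the arbitrary choice in \<open>weak_gradient\<close> to be replaced by any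
  concrete weak gradient inside norms and integrals.\<close>

lemma
  fixes u :: "'a::euclidean_space \<Rightarrow> real"
  assumes "open \<Omega>" "has_weak_gradient \<Omega> u g"
  shows weak_gradient_in_Lp_space_iff: "weak_gradient \<Omega> u \<in> Lp_space p \<Omega> \<longleftrightarrow> g \<in> Lp_space p \<Omega>"
    and Lp_norm_weak_gradient: "Lp_norm p \<Omega> (weak_gradient \<Omega> u) = Lp_norm p \<Omega> g"
    and integral_powr_diff_weak_gradient: "f \<in> borel_measurable (lebesgue_on \<Omega>) \<Longrightarrow>
      (\<integral>x. norm (weak_gradient \<Omega> u x - f x) powr p \<partial>lebesgue_on \<Omega>) =
      (\<integral>x. norm (g x - f x) powr p \<partial>lebesgue_on \<Omega>)"
proof -
  have "has_weak_gradient \<Omega> u (weak_gradient \<Omega> u)"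
    using someI[of "has_weak_gradient \<Omega> u", OF assms(2)] unfolding weak_gradient_def .
  then have m: "weak_gradient \<Omega> u \<in> borel_measurable (lebesgue_on \<Omega>)" "g \<in> borel_measurable (lebesgue_on \<Omega>)"
    using assms locally_integrable_measurable by (auto simp: has_weak_gradient_def)
  note ae = weak_gradient_AE_eq[OF assms]
  have ae': "AE x in lebesgue_on \<Omega>. norm (weak_gradient \<Omega> u x) powr p = norm (g x) powr p"
    using ae by eventually_elim simp
  show iff: "weak_gradient \<Omega> u \<in> Lp_space p \<Omega> \<longleftrightarrow> g \<in> Lp_space p \<Omega>"
    using m integrable_cong_AE[OF _ _ ae'] by (auto simp: Lp_space_def)
  show "Lp_norm p \<Omega> (weak_gradient \<Omega> u) = Lp_norm p \<Omega> g"
    unfolding Lp_norm_def iff using m integral_cong_AE[OF _ _ ae'] by auto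
  assume "f \<in> borel_measurable (lebesgue_on \<Omega>)"
  then show "(\<integral>x. norm (weak_gradient \<Omega> u x - f x) powr p \<partial>lebesgue_on \<Omega>) =
      (\<integral>x. norm (g x - f x) powr p \<partial>lebesgue_on \<Omega>)"
    using m ae by (intro integral_cong_AE) auto
qed

section \<open>A Morrey estimate\<close>

text \<open>Young's inequality with second factor 1, equivalently the tangent line of the p-th power
  at 1. Rescaled, it serves below both in place of Hoelder and as the convexity input in place of
  Minkowski.\<close>

lemma young_one:
  fixes a p :: real
  assumes "a \<ge> 0" "p \<ge> 1"
  shows "a \<le> a powr p / p + (1 - 1 / p)"
proof (cases "a = 0")
  case False
  then have "(a powr p) powr (1 / p) * 1 powr (1 - 1 / p) \<le> 1 / p * (a powr p) + (1 - 1 / p) * 1"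
    using assms by (intro Youngs_inequality_0) auto
  then show ?thesis using assms False by (simp add: powr_powr)
qed (use assms in simp)

lemma measure_cube:
  assumes "h > 0"
  shows "measure lborel (cbox (- (h *\<^sub>R One)) (h *\<^sub>R One :: 'a::euclidean_space)) = (2 * h) ^ DIM('a)"
proof -
  have "(\<Prod>b\<in>(Basis::'a set). (h *\<^sub>R One - (- (h *\<^sub>R One))) \<bullet> b) = (\<Prod>b\<in>(Basis::'a set). 2 * h)"
    by (intro prod.cong) (auto simp: inner_diff_left inner_add_left)
  moreover have "cbox (- (h *\<^sub>R One)) (h *\<^sub>R One :: 'a) \<noteq> {}"
    using assms by (auto simp: box_eq_empty inner_minus_left not_less)
  ultimately show ?thesis by (simp add: content_cbox')
qed

text \<open>Hoelder's inequality on the cube of half-side h t centred at \<open>x\<close>, rewritten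
  over the fixed cube. It comes from integrating the rescaled Young inequality with the scale at
  which it is sharp.\<close>

lemma cube_integral_bound:
  fixes g :: "'a::euclidean_space \<Rightarrow> real"
  defines "N \<equiv> real DIM('a)"
  assumes g: "continuous_on UNIV g" "\<And>x. g x \<ge> 0" "compact S" "\<And>x. g x \<noteq> 0 \<Longrightarrow> x \<in> S"
    and p: "p \<ge> 1" and "K > 0" "(\<integral>x. g x powr p \<partial>lborel) \<le> K powr p"
    and "h > 0" "t > 0"
  shows "integral (cbox (- (h *\<^sub>R One)) (h *\<^sub>R One)) (\<lambda>z. g (x + t *\<^sub>R z)) \<le>
    (2 * h) ^ DIM('a) * (K * (2 * h * t) powr (- N / p))"
proof -
  define Q :: "'a set" where "Q = cbox (- (h *\<^sub>R One)) (h *\<^sub>R One)"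
  define V where "V = (2 * h) ^ DIM('a)"
  \<comment> \<open>The largest p-mean that \<open>g\<close> can have over a cube of volume
    \<open>V * t ^ DIM('a)\<close>. With this scale the two Young terms become V c / p and V c (1 -
    1/p), with sum V c.\<close>
  define c where "c = K * (V * t ^ DIM('a)) powr (- 1 / p)"
  have V: "V > 0" "measure lborel Q = V"
    using \<open>h > 0\<close> measure_cube[of h, where 'a = 'a] by (auto simp: V_def Q_def)
  have c: "c > 0" using \<open>K > 0\<close> V(1) \<open>t > 0\<close> by (simp add: c_def)
  have cp: "c powr p = K powr p / (V * t ^ DIM('a))"
  proof -
    have "(W powr (- 1 / p)) powr p = 1 / W" if "W > 0" for W :: real
    proof -
      have "- 1 / p * p = - 1" using p by simp
      then show ?thesis using that by (simp only: powr_powr) (simp add: powr_minus_divide)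
    qed
    then show ?thesis
      unfolding c_def using V(1) \<open>t > 0\<close> by (simp only: powr_mult) simp
  qed
  have gc: "continuous_on S' (\<lambda>z. g (x + t *\<^sub>R z))" for S'
    by (intro continuous_on_compose2[OF g(1)] continuous_intros) auto
  have gpc: "continuous_on UNIV (\<lambda>z. g z powr p)"
    using p by (intro continuous_on_powr' continuous_intros g(1)) (auto simp: g(2))
  have int: "integrable lborel (\<lambda>z. g z powr p)"
    using g(4) by (intro integrable_compact_support[OF gpc g(3)]) auto
  have gpc': "continuous_on S' (\<lambda>z. g (x + t *\<^sub>R z) powr p)" for S'
    using p by (intro continuous_on_powr' continuous_intros gc) (auto simp: g(2))
  have Qp: "integral Q (\<lambda>z. g (x + t *\<^sub>R z) powr p) \<le> K powr p / t ^ DIM('a)"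
  proof -
    have i: "integrable lborel (\<lambda>z. g (x + t *\<^sub>R z) powr p)"
      by (rule lborel_integrable_affine[OF int]) (use \<open>t > 0\<close> in simp)
    have "integral Q (\<lambda>z. g (x + t *\<^sub>R z) powr p) \<le> integral UNIV (\<lambda>z. g (x + t *\<^sub>R z) powr p)"
    proof (rule integral_subset_le)
      show "(\<lambda>z. g (x + t *\<^sub>R z) powr p) integrable_on Q"
        unfolding Q_def by (intro integrable_continuous gpc')
      show "(\<lambda>z. g (x + t *\<^sub>R z) powr p) integrable_on UNIV"
        using has_integral_integral_lborel[OF i] by (rule has_integral_integrable)
    qed auto
    also have "\<dots> = (\<integral>z. g z powr p \<partial>lborel) / t ^ DIM('a)"
      unfolding integral_lborel[OF i]
      using lborel_integral_affine[OF int, of t x] \<open>t > 0\<close> by (simp add: field_simps)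
    also have "\<dots> \<le> K powr p / t ^ DIM('a)"
      using \<open>(\<integral>x. g x powr p \<partial>lborel) \<le> K powr p\<close> \<open>t > 0\<close> by (intro divide_right_mono) auto
    finally show ?thesis .
  qed
  have "integral Q (\<lambda>z. g (x + t *\<^sub>R z)) \<le>
      integral Q (\<lambda>z. (c / (p * c powr p)) * g (x + t *\<^sub>R z) powr p + c * (1 - 1 / p))"
    unfolding Q_def
  proof (rule integral_le)
    show "(\<lambda>z. g (x + t *\<^sub>R z)) integrable_on cbox (- (h *\<^sub>R One)) (h *\<^sub>R One)"
      by (intro integrable_continuous gc)
    show "(\<lambda>z. (c / (p * c powr p)) * g (x + t *\<^sub>R z) powr p + c * (1 - 1 / p))
        integrable_on cbox (- (h *\<^sub>R One)) (h *\<^sub>R One)"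
      by (intro integrable_continuous continuous_intros gpc')
    fix z
    have "c * (g (x + t *\<^sub>R z) / c) \<le> c * ((g (x + t *\<^sub>R z) / c) powr p / p + (1 - 1 / p))"
      using c p g(2) by (intro mult_left_mono young_one) auto
    then show "g (x + t *\<^sub>R z) \<le> (c / (p * c powr p)) * g (x + t *\<^sub>R z) powr p + c * (1 - 1 / p)"
      using c g(2) by (simp add: powr_divide distrib_left mult.commute)
  qed
  also have "\<dots> = (c / (p * c powr p)) * integral Q (\<lambda>z. g (x + t *\<^sub>R z) powr p) + V * (c * (1 - 1 / p))"
  proof -
    have "(\<lambda>z. (c / (p * c powr p)) * g (x + t *\<^sub>R z) powr p) integrable_on Q"
      unfolding Q_def by (intro integrable_continuous continuous_intros gpc')
    then show ?thesis
      using V(2) by (subst integral_add) (auto simp: Q_def)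
  qed
  also have "\<dots> \<le> (c / (p * c powr p)) * (K powr p / t ^ DIM('a)) + V * (c * (1 - 1 / p))"
    using Qp c p by (intro add_right_mono mult_left_mono) auto
  also have "\<dots> = V * c"
    using c p V(1) \<open>t > 0\<close> \<open>K > 0\<close> by (simp add: cp field_simps)
  also have "c = K * (2 * h * t) powr (- N / p)"
  proof -
    have "V * t ^ DIM('a) = (2 * h * t) powr N"
      using \<open>h > 0\<close> \<open>t > 0\<close> powr_realpow[of "2 * h * t" "DIM('a)"]
      by (simp add: V_def N_def power_mult_distrib)
    then show ?thesis by (simp add: c_def powr_powr)
  qed
  finally show ?thesis by (simp add: Q_def V_def)
qed

lemma norm_le_in_cube:
  assumes "z \<in> cbox (- (h *\<^sub>R One)) (h *\<^sub>R One :: 'a::euclidean_space)"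
  shows "norm z \<le> h * DIM('a)"
proof -
  have "norm z \<le> (\<Sum>b\<in>Basis. \<bar>z \<bullet> b\<bar>)" by (rule norm_le_l1)
  also have "\<dots> \<le> (\<Sum>b\<in>(Basis::'a set). h)"
    using assms by (intro sum_mono) (auto simp: mem_box abs_le_iff inner_minus_left minus_le_iff)
  finally show ?thesis by (simp add: mult.commute)
qed

text \<open>Both points are compared with the averages of \<open>\<phi>\<close> over cubes of side \<open>2 h\<close> centred at
  them, so that only the difference of the averages carries the factor \<open>norm (x - y)\<close>, with a
  constant that tends to 1 as \<open>p\<close> grows and \<open>h\<close> stays fixed.\<close>

lemma morrey_test_function:
  fixes \<phi> :: "'a::euclidean_space \<Rightarrow> real"
  defines "N \<equiv> real DIM('a)"
  assumes \<phi>: "\<phi> \<in> test_functions UNIV" and p: "p \<ge> 2 * N"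
    and K: "K > 0" "(\<integral>x. norm (grad \<phi> x) powr p \<partial>lborel) \<le> K powr p" and "h > 0"
  shows "\<bar>\<phi> x - \<phi> y\<bar> \<le> K * (2 * h) powr (- N / p) * (norm (x - y) + 4 * h * N)"
proof -
  obtain S where S: "smooth_fun \<phi>" "compact S" "\<And>x. grad \<phi> x \<noteq> 0 \<Longrightarrow> x \<in> S"
    using test_functionsD[OF \<phi>] by metis
  define Q :: "'a set" where "Q = cbox (- (h *\<^sub>R One)) (h *\<^sub>R One)"
  define V where "V = (2 * h) ^ DIM('a)"
  define M where "M = V * (K * (2 * h) powr (- N / p))"
  have N: "N \<ge> 1" using DIM_positive[where 'a = 'a] by (simp add: N_def Suc_leI)
  have V: "V > 0" "measure lborel Q = V"
    using \<open>h > 0\<close> measure_cube[of h, where 'a = 'a] by (auto simp: V_def Q_def)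
  have p1: "p \<ge> 1" using p N by simp
  have cgr: "continuous_on UNIV (grad \<phi>)" using smooth_fun_continuous_grad[OF S(1)] .
  have gb: "integral Q (\<lambda>z. norm (grad \<phi> (x + t *\<^sub>R z))) \<le> M * t powr (- N / p)" if "t > 0" for x t
  proof -
    have "integral Q (\<lambda>z. norm (grad \<phi> (x + t *\<^sub>R z))) \<le> V * (K * (2 * h * t) powr (- N / p))"
      unfolding Q_def V_def N_def
      using S(3) K p1 \<open>h > 0\<close> \<open>t > 0\<close> cgr
      by (intro cube_integral_bound[OF _ _ S(2)] continuous_intros) auto
    then show ?thesis using \<open>h > 0\<close> \<open>t > 0\<close> by (simp add: M_def powr_mult mult_ac)
  qed
  have ib: "\<bar>integral Q (\<lambda>z. grad \<phi> (\<alpha> z) \<bullet> \<beta> z)\<bar> \<le> B * integral Q (\<lambda>z. norm (grad \<phi> (\<alpha> z)))"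
    if "continuous_on UNIV \<alpha>" "continuous_on UNIV \<beta>" "\<And>z. z \<in> Q \<Longrightarrow> norm (\<beta> z) \<le> B" for \<alpha> \<beta> :: "'a \<Rightarrow> 'a" and B
  proof -
    have c: "continuous_on Q (\<lambda>z. grad \<phi> (\<alpha> z))" "continuous_on Q \<beta>"
      using continuous_on_subset[OF that(2)] continuous_on_subset[OF that(1), of Q]
      by (auto intro: continuous_on_compose2[OF cgr])
    have "norm (integral Q (\<lambda>z. grad \<phi> (\<alpha> z) \<bullet> \<beta> z)) \<le> integral Q (\<lambda>z. B * norm (grad \<phi> (\<alpha> z)))"
    proof (rule integral_norm_bound_integral)
      show "(\<lambda>z. grad \<phi> (\<alpha> z) \<bullet> \<beta> z) integrable_on Q" "(\<lambda>z. B * norm (grad \<phi> (\<alpha> z))) integrable_on Q"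
        using c unfolding Q_def by (auto intro!: integrable_continuous continuous_intros)
      show "norm (grad \<phi> (\<alpha> z) \<bullet> \<beta> z) \<le> B * norm (grad \<phi> (\<alpha> z))" if "z \<in> Q" for z
        using Cauchy_Schwarz_ineq2[of "grad \<phi> (\<alpha> z)" "\<beta> z"]
          mult_left_mono[OF \<open>\<And>z. z \<in> Q \<Longrightarrow> norm (\<beta> z) \<le> B\<close>[OF that], of "norm (grad \<phi> (\<alpha> z))"]
        by (simp add: mult.commute)
    qed
    then show ?thesis by simp
  qed
  have centre: "\<bar>integral Q (\<lambda>z. \<phi> (x + z)) - V * \<phi> x\<bar> \<le> M * (2 * h * N)" for x
  proof -
    define F where "F t = integral Q (\<lambda>z. \<phi> (x + t *\<^sub>R z))" for t
    define F' where "F' t = integral Q (\<lambda>z. grad \<phi> (x + t *\<^sub>R z) \<bullet> z)" for t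
    \<comment> \<open>The power -N/p of t is integrable at 0 with antiderivative of exponent
      \<open>s\<close>; the assumption \<open>p \<ge> 2 * N\<close> gives 1/s at most 2, the source
      of the constant 2 in the bound.\<close>
    define s where "s = 1 - N / p"
    have s: "s \<ge> 1 / 2" using p N by (simp add: s_def field_simps)
    define G where "G t = h * N * M / s * t powr s" for t
    have DF: "(F has_real_derivative F' t) (at t)" for t
      unfolding F_def F'_def Q_def by (intro has_derivative_integral_along_segments S continuous_intros)
    have DG: "(G has_real_derivative h * N * M * t powr (- N / p)) (at t)" if "t > 0" for t
      unfolding G_def using that s
      by (auto intro!: derivative_eq_intros simp: s_def)
    have F': "\<bar>F' t\<bar> \<le> h * N * M * t powr (- N / p)" if "t > 0" for t
    proof -
      have "\<bar>F' t\<bar> \<le> h * N * integral Q (\<lambda>z. norm (grad \<phi> (x + t *\<^sub>R z)))"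
        unfolding F'_def using norm_le_in_cube[where 'a = 'a and h = h]
        by (intro ib continuous_intros) (auto simp: Q_def N_def)
      also have "\<dots> \<le> h * N * (M * t powr (- N / p))"
        using gb[OF that] \<open>h > 0\<close> N by (intro mult_left_mono) auto
      finally show ?thesis by simp
    qed
    have cF: "continuous_on {0..1} F"
      using DF by (intro DERIV_continuous_on) (auto intro: has_field_derivative_at_within)
    have cG: "continuous_on {0..1} G"
      unfolding G_def using s by (intro continuous_intros continuous_on_powr') auto
    \<comment> \<open>\<open>G\<close> has the bound for \<bar>\<open>F'\<close>\<bar> as its
      derivative, so G + F and G - F are both nondecreasing. The bound may blow up at 0, so
      derivatives are used only inside the interval, with continuity at its ends.\<close>
    have "G 0 + \<sigma> * F 0 \<le> G 1 + \<sigma> * F 1" if "\<bar>\<sigma>\<bar> = 1" for \<sigma>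
    proof (rule DERIV_nonneg_imp_increasing_open[where f = "\<lambda>t. G t + \<sigma> * F t"])
      fix t :: real assume t: "0 < t" "t < 1"
      have "((\<lambda>t. G t + \<sigma> * F t) has_real_derivative h * N * M * t powr (- N / p) + \<sigma> * F' t) (at t)"
        using DF DG[OF t(1)] by (auto intro!: derivative_eq_intros)
      moreover have "\<bar>\<sigma> * F' t\<bar> \<le> h * N * M * t powr (- N / p)"
        using F'[OF t(1)] that by (simp add: abs_mult)
      ultimately show "\<exists>y. ((\<lambda>t. G t + \<sigma> * F t) has_real_derivative y) (at t) \<and> y \<ge> 0"
        by (intro exI conjI) (assumption, linarith)
    qed (auto intro!: continuous_intros cF cG)
    from this[of 1] this[of "-1"] have "\<bar>F 1 - F 0\<bar> \<le> G 1 - G 0" by (simp add: abs_le_iff)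
    also have "\<dots> = h * N * M / s" by (simp add: G_def)
    also have "\<dots> \<le> h * N * M / (1 / 2)"
      using s \<open>h > 0\<close> N V K by (intro divide_left_mono) (auto simp: M_def)
    finally show ?thesis using V(2) by (simp add: F_def Q_def mult_ac)
  qed
  have shift: "\<bar>integral Q (\<lambda>z. \<phi> (x + z)) - integral Q (\<lambda>z. \<phi> (y + z))\<bar> \<le> M * norm (x - y)"
  proof -
    define F where "F t = integral Q (\<lambda>z. \<phi> ((y + z) + t *\<^sub>R (x - y)))" for t
    define F' where "F' t = integral Q (\<lambda>z. grad \<phi> ((y + z) + t *\<^sub>R (x - y)) \<bullet> (x - y))" for t
    have DF: "(F has_real_derivative F' t) (at t)" for t
      unfolding F_def F'_def Q_def by (intro has_derivative_integral_along_segments S continuous_intros)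
    obtain t where t: "F 1 - F 0 = (1 - 0) * F' t"
      using MVT2[of 0 1 F F'] DF by auto
    have "\<bar>F' t\<bar> \<le> norm (x - y) * integral Q (\<lambda>z. norm (grad \<phi> ((y + z) + t *\<^sub>R (x - y))))"
      unfolding F'_def by (intro ib continuous_intros) auto
    also have "\<dots> = norm (x - y) * integral Q (\<lambda>z. norm (grad \<phi> ((y + t *\<^sub>R (x - y)) + 1 *\<^sub>R z)))"
      by (simp add: add_ac)
    \<comment> \<open>The cube is translated, not shrunk: the gradient bound is used at t = 1, so no
      factor beyond \<open>M\<close> multiplies the distance.\<close>
    also have "\<dots> \<le> norm (x - y) * (M * 1 powr (- N / p))"
      by (intro mult_left_mono gb) auto
    finally show ?thesis using t by (simp add: F_def algebra_simps)
  qed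
  have "V * \<bar>\<phi> x - \<phi> y\<bar> = \<bar>V * \<phi> x - V * \<phi> y\<bar>"
    using V(1) by (simp add: right_diff_distrib[symmetric] abs_mult)
  also have "\<dots> \<le> M * (2 * h * N) + M * norm (x - y) + M * (2 * h * N)"
    using centre[of x] centre[of y] shift by linarith
  also have "\<dots> = V * (K * (2 * h) powr (- N / p) * (norm (x - y) + 4 * h * N))"
    by (simp add: M_def algebra_simps)
  finally show ?thesis using V(1) by simp
qed

section \<open>Pointwise estimates for Sobolev functions\<close>

lemma Lp_norm_powr:
  assumes "f \<in> Lp_space p \<Omega>" "p > 0"
  shows "Lp_norm p \<Omega> f powr p = (\<integral>x. norm (f x) powr p \<partial>lebesgue_on \<Omega>)"
  using assms by (simp add: Lp_norm_def powr_powr integral_nonneg_AE)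

lemma Lp_space_diff:
  assumes "f \<in> Lp_space p \<Omega>" "g \<in> Lp_space p \<Omega>" "p \<ge> 0"
  shows "(\<lambda>x. f x - g x) \<in> Lp_space p \<Omega>"
proof -
  have m: "f \<in> borel_measurable (lebesgue_on \<Omega>)" "g \<in> borel_measurable (lebesgue_on \<Omega>)"
    using assms by (auto simp: Lp_space_def)
  have "integrable (lebesgue_on \<Omega>) (\<lambda>x. norm (f x - g x) powr p)"
  proof (rule Bochner_Integration.integrable_bound)
    show "integrable (lebesgue_on \<Omega>) (\<lambda>x. 2 powr p * (norm (f x) powr p + norm (g x) powr p))"
      using assms by (auto simp: Lp_space_def)
    show "(\<lambda>x. norm (f x - g x) powr p) \<in> borel_measurable (lebesgue_on \<Omega>)"
      using m by measurable
    have "norm (f x - g x) powr p \<le> 2 powr p * (norm (f x) powr p + norm (g x) powr p)" for x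
    proof -
      let ?m = "max (norm (f x)) (norm (g x))"
      have "norm (f x - g x) powr p \<le> (2 * ?m) powr p"
        using norm_triangle_ineq4[of "f x" "g x"] assms(3) by (intro powr_mono2) auto
      also have "\<dots> = 2 powr p * ?m powr p" by (simp add: powr_mult)
      also have "\<dots> \<le> 2 powr p * (norm (f x) powr p + norm (g x) powr p)"
        by (intro mult_left_mono) (auto simp: max_def)
      finally show ?thesis .
    qed
    then show "AE x in lebesgue_on \<Omega>. norm (norm (f x - g x) powr p)
        \<le> norm (2 powr p * (norm (f x) powr p + norm (g x) powr p))"
      by (intro AE_I2) (simp add: abs_of_nonneg)
  qed
  then show ?thesis using m by (auto simp: Lp_space_def)
qed

lemma compact_support_in_Lp_space:
  fixes f :: "'a::euclidean_space \<Rightarrow> 'b::euclidean_space"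
  assumes "continuous_on UNIV f" "compact K" "\<And>x. f x \<noteq> 0 \<Longrightarrow> x \<in> K" "\<Omega> \<in> sets lebesgue" "p > 0"
  shows "f \<in> Lp_space p \<Omega>"
proof -
  have "continuous_on UNIV (\<lambda>x. norm (f x) powr p)"
    using assms by (intro continuous_on_powr' continuous_intros) auto
  then have "integrable (lebesgue_on \<Omega>) (\<lambda>x. norm (f x) powr p)"
    using assms(3,4) by (intro integrable_lebesgue_on_compact_support[OF _ assms(2)]) auto
  moreover have "f \<in> borel_measurable (lebesgue_on \<Omega>)"
    using integrable_lebesgue_on_compact_support[OF assms(1-4)] by auto
  ultimately show ?thesis by (simp add: Lp_space_def)
qed

lemma
  assumes "open \<Omega>" "\<phi> \<in> test_functions \<Omega>" "p > 0"
  shows test_function_in_Lp_space: "\<phi> \<in> Lp_space p \<Omega>"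
    and grad_test_function_in_Lp_space: "grad \<phi> \<in> Lp_space p \<Omega>"
proof -
  obtain K where K: "smooth_fun \<phi>" "compact K" "\<And>x. \<phi> x \<noteq> 0 \<Longrightarrow> x \<in> K" "\<And>x. grad \<phi> x \<noteq> 0 \<Longrightarrow> x \<in> K"
    using test_functionsD[OF assms(2)] by metis
  show "\<phi> \<in> Lp_space p \<Omega>" "grad \<phi> \<in> Lp_space p \<Omega>"
    using K assms smooth_fun_continuous[OF K(1)] smooth_fun_continuous_grad[OF K(1)]
    by (auto intro!: compact_support_in_Lp_space)
qed

text \<open>The constant sequence approximates; the work lies in the zero function, whose chosen
  \<open>weak_gradient\<close> is controlled only through its norm.\<close>

lemma test_function_in_sobolev_space_0:
  fixes \<Omega> :: "'a::euclidean_space set"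
  assumes "open \<Omega>" "\<phi> \<in> test_functions \<Omega>" "p > 0"
  shows "\<phi> \<in> sobolev_space_0 p \<Omega>"
proof -
  have "(\<lambda>x. 0) \<in> test_functions \<Omega>"
    using test_function_cmult[OF assms(2), of 0] by simp
  then have "has_weak_gradient \<Omega> (\<lambda>x. 0) (grad (\<lambda>x. 0))"
    by (rule test_function_has_weak_gradient[OF assms(1)])
  then have "Lp_norm p \<Omega> (weak_gradient \<Omega> (\<lambda>x. 0)) = Lp_norm p \<Omega> (grad (\<lambda>x. 0) :: 'a \<Rightarrow> 'a)"
    by (rule Lp_norm_weak_gradient[OF assms(1)])
  also have "\<dots> = 0"
  proof -
    have "grad (\<lambda>x. 0) = (\<lambda>x::'a. 0)"
      using grad_cmult[OF smooth_fun_const[of 0], of 0] by (auto simp: fun_eq_iff)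
    then show ?thesis by (simp add: Lp_norm_def)
  qed
  finally have "Lp_norm p \<Omega> (weak_gradient \<Omega> (\<lambda>x. 0)) = 0" .
  then have "sobolev_norm p \<Omega> (\<lambda>x. \<phi> x - \<phi> x) = 0"
    by (simp add: sobolev_norm_def Lp_norm_def)
  then show ?thesis
    using assms test_function_has_weak_gradient[OF assms(1,2)] test_function_in_Lp_space[OF assms]
      grad_test_function_in_Lp_space[OF assms]
    unfolding sobolev_space_0_def sobolev_space_def
    by (auto intro!: exI[of _ "\<lambda>k. \<phi>"])
qed

lemma sobolev_space_0_approximation:
  fixes u :: "'a::euclidean_space \<Rightarrow> real"
  assumes "open \<Omega>" "p > 0" "u \<in> sobolev_space_0 p \<Omega>"
  obtains \<phi> where "\<And>k. \<phi> k \<in> test_functions \<Omega>" "u \<in> Lp_space p \<Omega>" "weak_gradient \<Omega> u \<in> Lp_space p \<Omega>"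
    "(\<lambda>k. \<integral>x. norm (u x - \<phi> k x) powr p \<partial>lebesgue_on \<Omega>) \<longlonglongrightarrow> 0"
    "(\<lambda>k. \<integral>x. norm (weak_gradient \<Omega> u x - grad (\<phi> k) x) powr p \<partial>lebesgue_on \<Omega>) \<longlonglongrightarrow> 0"
proof -
  obtain g \<phi> where u: "u \<in> Lp_space p \<Omega>" "g \<in> Lp_space p \<Omega>" "has_weak_gradient \<Omega> u g"
    and \<phi>: "\<And>k. \<phi> k \<in> test_functions \<Omega>"
    and lim: "(\<lambda>k. sobolev_norm p \<Omega> (\<lambda>x. u x - \<phi> k x)) \<longlonglongrightarrow> 0"
    using assms(3) by (auto simp: sobolev_space_0_def sobolev_space_def)
  let ?A = "\<lambda>k. \<integral>x. norm (u x - \<phi> k x) powr p \<partial>lebesgue_on \<Omega>"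
  let ?B = "\<lambda>k. \<integral>x. norm (weak_gradient \<Omega> u x - grad (\<phi> k) x) powr p \<partial>lebesgue_on \<Omega>"
  have eq: "?A k + ?B k = sobolev_norm p \<Omega> (\<lambda>x. u x - \<phi> k x) powr p" for k
  proof -
    note \<phi>L = test_function_in_Lp_space[OF assms(1) \<phi> assms(2)]
      grad_test_function_in_Lp_space[OF assms(1) \<phi> assms(2)]
    have w: "has_weak_gradient \<Omega> (\<lambda>x. u x - \<phi> k x) (\<lambda>x. g x - grad (\<phi> k) x)"
      using has_weak_gradient_diff[OF assms(1) u(3) test_function_has_weak_gradient[OF assms(1) \<phi>]] .
    have "?A k = Lp_norm p \<Omega> (\<lambda>x. u x - \<phi> k x) powr p"
      using Lp_space_diff[OF u(1) \<phi>L(1)] assms(2) by (simp add: Lp_norm_powr)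
    moreover have "?B k = (\<integral>x. norm (g x - grad (\<phi> k) x) powr p \<partial>lebesgue_on \<Omega>)"
      using \<phi>L(2)[of k] by (intro integral_powr_diff_weak_gradient[OF assms(1) u(3)]) (auto simp: Lp_space_def)
    moreover have "\<dots> = Lp_norm p \<Omega> (weak_gradient \<Omega> (\<lambda>x. u x - \<phi> k x)) powr p"
      using Lp_space_diff[OF u(2) \<phi>L(2)] assms(2)
      by (simp add: Lp_norm_weak_gradient[OF assms(1) w] Lp_norm_powr)
    ultimately show ?thesis
      using assms(2) by (simp add: sobolev_norm_def powr_powr)
  qed
  have "(\<lambda>k. sobolev_norm p \<Omega> (\<lambda>x. u x - \<phi> k x) powr p) \<longlonglongrightarrow> 0 powr p"
    using assms(2) lim by (intro tendsto_powr') (auto simp: sobolev_norm_def)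
  then have AB: "(\<lambda>k. ?A k + ?B k) \<longlonglongrightarrow> 0" unfolding eq by simp
  have nn: "?A k \<ge> 0" "?B k \<ge> 0" for k by (auto intro: integral_nonneg_AE)
  show ?thesis
  proof (rule that[OF \<phi> u(1)])
    show "weak_gradient \<Omega> u \<in> Lp_space p \<Omega>"
      using weak_gradient_in_Lp_space_iff[OF assms(1) u(3)] u(2) by simp
    show "?A \<longlonglongrightarrow> 0"
      by (rule tendsto_sandwich[OF _ _ tendsto_const AB]) (use nn in auto)
    show "?B \<longlonglongrightarrow> 0"
      by (rule tendsto_sandwich[OF _ _ tendsto_const AB]) (use nn in auto)
  qed
qed

text \<open>Convexity of the p-th power, since x + y is the average of x / (1 - s) and y / s with
  weights 1 - s and s. It stands in for Minkowski's inequality: the term in \<open>x\<close> is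
  nearly undistorted for small \<open>s\<close>, the one in \<open>y\<close> is large but will tend
  to 0.\<close>

lemma powr_add_le:
  fixes x y s p :: real
  assumes "x \<ge> 0" "y \<ge> 0" "0 < s" "s < 1" "p \<ge> 1"
  shows "(x + y) powr p \<le> (1 - s) * (x / (1 - s)) powr p + s * (y / s) powr p"
proof (cases "x + y = 0")
  case False
  define c where "c = x + y"
  have c: "c > 0" using False assms by (simp add: c_def)
  have t: "1 + p * (z / c - 1) \<le> z powr p / c powr p" if "z \<ge> 0" for z
  proof -
    have "p * (z / c) \<le> p * ((z / c) powr p / p + (1 - 1 / p))"
      using young_one[of "z / c" p] that c assms by (intro mult_left_mono) auto
    then show ?thesis using assms that c by (simp add: powr_divide algebra_simps)
  qed
  \<comment> \<open>The tangent lines at \<open>c\<close> average exactly to the value at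
    \<open>c\<close>, because the weighted mean of the two points is \<open>c\<close>.\<close>
  have "1 = (1 - s) * (1 + p * (x / (1 - s) / c - 1)) + s * (1 + p * (y / s / c - 1))"
    using assms c by (simp add: field_simps) (simp add: c_def algebra_simps)
  also have "\<dots> \<le> (1 - s) * ((x / (1 - s)) powr p / c powr p) + s * ((y / s) powr p / c powr p)"
    using assms by (intro add_mono mult_left_mono t) auto
  also have "\<dots> = ((1 - s) * (x / (1 - s)) powr p + s * (y / s) powr p) / c powr p"
    by (simp add: add_divide_distrib)
  finally show ?thesis using c by (simp add: c_def pos_le_divide_eq)
qed (use assms in \<open>simp add: add_nonneg_eq_0_iff\<close>)

lemma eventually_integral_powr_le:
  fixes f :: "'a::euclidean_space \<Rightarrow> 'b::euclidean_space"
  assumes "p \<ge> 1" "f \<in> Lp_space p \<Omega>" "\<And>k. g k \<in> Lp_space p \<Omega>"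
    "(\<lambda>k::nat. \<integral>x. norm (f x - g k x) powr p \<partial>lebesgue_on \<Omega>) \<longlonglongrightarrow> 0"
    and K: "K > Lp_norm p \<Omega> f"
  shows "\<forall>\<^sub>F k in sequentially. (\<integral>x. norm (g k x) powr p \<partial>lebesgue_on \<Omega>) \<le> K powr p"
proof -
  define L where "L = Lp_norm p \<Omega> f"
  have L: "L \<ge> 0" "L < K" using K by (auto simp: L_def Lp_norm_def)
  \<comment> \<open>Then 1 - s = (K + L) / (2 K), so L / (1 - s) = 2 K L / (K + L) stays below
    \<open>K\<close>.\<close>
  define s where "s = (K - L) / (2 * K)"
  have s: "0 < s" "s < 1" "L / (1 - s) < K"
  proof -
    have "1 - s = (K + L) / (2 * K)" using L by (simp add: s_def field_simps)
    then show "0 < s" "s < 1" "L / (1 - s) < K"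
      using L by (auto simp: s_def divide_simps distrib_left)
  qed
  let ?I = "\<lambda>k. \<integral>x. norm (f x - g k x) powr p \<partial>lebesgue_on \<Omega>"
  have "(\<integral>x. norm (g k x) powr p \<partial>lebesgue_on \<Omega>) \<le>
      (1 - s) * (L / (1 - s)) powr p + s * (1 / s) powr p * ?I k" for k
  proof -
    have d: "(\<lambda>x. f x - g k x) \<in> Lp_space p \<Omega>"
      using Lp_space_diff assms by (metis order_trans zero_le_one)
    have "(\<integral>x. norm (g k x) powr p \<partial>lebesgue_on \<Omega>) \<le>
        (\<integral>x. (1 - s) * (1 / (1 - s)) powr p * norm (f x) powr p
          + s * (1 / s) powr p * norm (f x - g k x) powr p \<partial>lebesgue_on \<Omega>)"
    proof (rule integral_mono)
      fix x
      have "norm (g k x) powr p \<le> (norm (f x) + norm (f x - g k x)) powr p"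
        using norm_triangle_ineq4[of "f x" "f x - g k x"] assms(1) by (intro powr_mono2) auto
      also have "\<dots> \<le> (1 - s) * (norm (f x) / (1 - s)) powr p + s * (norm (f x - g k x) / s) powr p"
        using s assms(1) by (intro powr_add_le) auto
      finally show "norm (g k x) powr p \<le> (1 - s) * (1 / (1 - s)) powr p * norm (f x) powr p
          + s * (1 / s) powr p * norm (f x - g k x) powr p"
        using s by (simp add: powr_divide)
    qed (use assms(2,3) d in \<open>auto simp: Lp_space_def\<close>)
    also have "\<dots> = (1 - s) * (1 / (1 - s)) powr p * L powr p + s * (1 / s) powr p * ?I k"
      using assms(1,2) d Lp_norm_powr[OF assms(2)] by (simp add: L_def Lp_space_def)
    finally show ?thesis using s L by (simp add: powr_divide)
  qed
  moreover have "\<forall>\<^sub>F k in sequentially.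
      (1 - s) * (L / (1 - s)) powr p + s * (1 / s) powr p * ?I k < K powr p"
  proof (rule order_tendstoD(2))
    show "(\<lambda>k. (1 - s) * (L / (1 - s)) powr p + s * (1 / s) powr p * ?I k) \<longlonglongrightarrow>
        (1 - s) * (L / (1 - s)) powr p + s * (1 / s) powr p * 0"
      by (intro tendsto_intros assms(4))
    have "(1 - s) * (L / (1 - s)) powr p \<le> 1 * (L / (1 - s)) powr p"
      using s by (intro mult_right_mono) auto
    also have "\<dots> < K powr p"
      using s L assms(1) by (auto intro!: powr_less_mono2)
    finally show "(1 - s) * (L / (1 - s)) powr p + s * (1 / s) powr p * 0 < K powr p" by simp
  qed
  ultimately show ?thesis
    by (auto elim!: eventually_mono intro: order_trans less_imp_le)
qed

text \<open>A nonempty open set is not null, so no ball around a point of \<open>\<Omega>\<close>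
  can avoid the good set.\<close>

lemma dense_subset_of_AE:
  fixes \<Omega> :: "'a::euclidean_space set"
  assumes "open \<Omega>" "AE x in lebesgue_on \<Omega>. P x"
  shows "\<Omega> \<subseteq> closure {x \<in> \<Omega>. P x}"
proof
  fix x assume "x \<in> \<Omega>"
  have "AE x in lebesgue. x \<in> \<Omega> \<longrightarrow> P x"
    using assms by (simp add: AE_restrict_space_iff)
  then obtain N where N: "N \<in> null_sets lebesgue" "{x. \<not> (x \<in> \<Omega> \<longrightarrow> P x)} \<subseteq> N"
    by (auto simp: eventually_ae_filter)
  show "x \<in> closure {x \<in> \<Omega>. P x}"
    unfolding closure_approachable
  proof (intro allI impI)
    fix e :: real assume "e > 0"
    have "\<not> negligible (\<Omega> \<inter> ball x e)"
      using assms(1) \<open>x \<in> \<Omega>\<close> \<open>e > 0\<close> by (intro open_not_negligible) auto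
    then have "\<not> \<Omega> \<inter> ball x e \<subseteq> N"
      using N(1) negligible_subset negligible_iff_null_sets by blast
    then show "\<exists>y\<in>{x \<in> \<Omega>. P x}. dist y x < e"
      using N(2) by (auto simp: dist_commute)
  qed
qed

text \<open>The bound for approximating test functions passes to an almost everywhere convergent
  subsequence, then to all of \<open>\<Omega>\<close> by density and continuity. Test functions
  vanish off \<open>\<Omega>\<close>, so the extension by zero is their pointwise limit
  there.\<close>

lemma morrey_sobolev_space_0:
  fixes u :: "'a::euclidean_space \<Rightarrow> real"
  defines "N \<equiv> real DIM('a)"
  assumes "open \<Omega>" "p \<ge> 2 * N" "u \<in> sobolev_space_0 p \<Omega>" "continuous_on \<Omega> u" "h > 0"
  defines "v \<equiv> (\<lambda>x. if x \<in> \<Omega> then u x else 0)"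
  shows "\<bar>v x - v y\<bar> \<le> Lp_norm p \<Omega> (weak_gradient \<Omega> u) * (2 * h) powr (- N / p) * (norm (x - y) + 4 * h * N)"
proof -
  define L where "L = Lp_norm p \<Omega> (weak_gradient \<Omega> u)"
  define c where "c = (2 * h) powr (- N / p)"
  have N: "N \<ge> 1" using DIM_positive[where 'a = 'a] by (simp add: N_def Suc_leI)
  then have p: "p \<ge> 1" "p > 0" using assms(3) by auto
  have L: "L \<ge> 0" by (simp add: L_def Lp_norm_def)
  obtain \<phi> where \<phi>: "\<And>k. \<phi> k \<in> test_functions \<Omega>" "u \<in> Lp_space p \<Omega>" "weak_gradient \<Omega> u \<in> Lp_space p \<Omega>"
    "(\<lambda>k. \<integral>x. norm (u x - \<phi> k x) powr p \<partial>lebesgue_on \<Omega>) \<longlonglongrightarrow> 0"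
    "(\<lambda>k. \<integral>x. norm (weak_gradient \<Omega> u x - grad (\<phi> k) x) powr p \<partial>lebesgue_on \<Omega>) \<longlonglongrightarrow> 0"
    using sobolev_space_0_approximation[OF assms(2) p(2) assms(4)] by blast
  have int: "integrable (lebesgue_on \<Omega>) (\<lambda>x. norm (u x - \<phi> k x) powr p)" for k
    using Lp_space_diff[OF \<phi>(2) test_function_in_Lp_space[OF assms(2) \<phi>(1)[of k] p(2)]] p
    by (simp add: Lp_space_def)
  have "(\<lambda>k. \<integral>x. norm (norm (u x - \<phi> k x) powr p) \<partial>lebesgue_on \<Omega>) \<longlonglongrightarrow> 0"
    using \<phi>(4) by simp
  from tendsto_L1_AE_subseq[OF int this]
  obtain r where r: "strict_mono r" "AE x in lebesgue_on \<Omega>. (\<lambda>n. norm (u x - \<phi> (r n) x) powr p) \<longlonglongrightarrow> 0"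
    by blast
  define G where "G = {x \<in> \<Omega>. (\<lambda>n. norm (u x - \<phi> (r n) x) powr p) \<longlonglongrightarrow> 0}"
  have G: "(\<lambda>n. \<phi> (r n) x) \<longlonglongrightarrow> v x" if "x \<in> G \<union> - \<Omega>" for x
  proof (cases "x \<in> \<Omega>")
    case True
    then have "(\<lambda>n. norm (u x - \<phi> (r n) x) powr p) \<longlonglongrightarrow> 0" using that by (auto simp: G_def)
    then have "(\<lambda>n. (norm (u x - \<phi> (r n) x) powr p) powr (1 / p)) \<longlonglongrightarrow> 0 powr (1 / p)"
      using p by (intro tendsto_powr') auto
    then have "(\<lambda>n. \<bar>u x - \<phi> (r n) x\<bar>) \<longlonglongrightarrow> 0" using p by (simp add: powr_powr)
    then have "(\<lambda>n. u x - (u x - \<phi> (r n) x)) \<longlonglongrightarrow> u x - 0"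
      by (intro tendsto_intros) (simp add: tendsto_rabs_zero_iff)
    then show ?thesis using True by (simp add: v_def)
  next
    case False
    have "\<phi> k x = 0" for k
    proof -
      obtain K where "K \<subseteq> \<Omega>" "\<And>x. \<phi> k x \<noteq> 0 \<Longrightarrow> x \<in> K"
        using test_functionsD[OF \<phi>(1)[of k]] by metis
      then show ?thesis using False by blast
    qed
    then show ?thesis using False by (simp add: v_def)
  qed
  \<comment> \<open>The approximating gradients may have norm slightly above \<open>L\<close>, so
    any larger \<open>K\<close> is used first and then lowered to \<open>L\<close>.\<close>
  have KG: "\<bar>v x - v y\<bar> \<le> K * (c * (norm (x - y) + 4 * h * N))"
    if "x \<in> G \<union> - \<Omega>" "y \<in> G \<union> - \<Omega>" "K > L" for x y K
  proof -
    have "\<forall>\<^sub>F k in sequentially. (\<integral>x. norm (grad (\<phi> k) x) powr p \<partial>lebesgue_on \<Omega>) \<le> K powr p"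
      using that(3) grad_test_function_in_Lp_space[OF assms(2) \<phi>(1) p(2)]
      by (intro eventually_integral_powr_le[OF p(1) \<phi>(3) _ \<phi>(5)]) (auto simp: L_def)
    then have ev: "\<forall>\<^sub>F n in sequentially. (\<integral>x. norm (grad (\<phi> (r n)) x) powr p \<partial>lebesgue_on \<Omega>) \<le> K powr p"
      using eventually_subseq[OF r(1)] by blast
    have "\<bar>\<phi> k x - \<phi> k y\<bar> \<le> K * c * (norm (x - y) + 4 * h * N)"
      if k: "(\<integral>x. norm (grad (\<phi> k) x) powr p \<partial>lebesgue_on \<Omega>) \<le> K powr p" for k
    proof -
      obtain S where S: "smooth_fun (\<phi> k)" "compact S" "S \<subseteq> \<Omega>" "\<And>x. \<phi> k x \<noteq> 0 \<Longrightarrow> x \<in> S"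
          "\<And>x. grad (\<phi> k) x \<noteq> 0 \<Longrightarrow> x \<in> S"
        using test_functionsD[OF \<phi>(1)[of k]] by metis
      have "continuous_on UNIV (\<lambda>x. norm (grad (\<phi> k) x) powr p)"
        using p smooth_fun_continuous_grad[OF S(1)] by (intro continuous_on_powr' continuous_intros) auto
      then have "(\<integral>x. norm (grad (\<phi> k) x) powr p \<partial>lebesgue_on \<Omega>) = (\<integral>x. norm (grad (\<phi> k) x) powr p \<partial>lborel)"
        using S(3,5) assms(2) by (intro integral_lebesgue_on_compact_support[OF _ S(2)]) auto
      moreover have "\<phi> k \<in> test_functions UNIV"
        using S by (intro test_functionsI) auto
      ultimately show ?thesis
        unfolding c_def N_def
        using k L \<open>K > L\<close> assms(3) \<open>h > 0\<close> by (intro morrey_test_function) (auto simp: N_def)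
    qed
    then have "\<forall>\<^sub>F n in sequentially. \<bar>\<phi> (r n) x - \<phi> (r n) y\<bar> \<le> K * (c * (norm (x - y) + 4 * h * N))"
      using ev by (auto elim!: eventually_mono simp: mult.assoc)
    moreover have "(\<lambda>n. \<bar>\<phi> (r n) x - \<phi> (r n) y\<bar>) \<longlonglongrightarrow> \<bar>v x - v y\<bar>"
      using G that by (intro tendsto_intros) auto
    ultimately show ?thesis
      by (intro tendsto_upperbound[of _ _ sequentially]) auto
  qed
  have LG: "\<bar>v x - v y\<bar> \<le> L * (c * (norm (x - y) + 4 * h * N))"
    if "x \<in> G \<union> - \<Omega>" "y \<in> G \<union> - \<Omega>" for x y
  proof (rule tendsto_lowerbound)
    show "((\<lambda>K. K * (c * (norm (x - y) + 4 * h * N))) \<longlongrightarrow> L * (c * (norm (x - y) + 4 * h * N))) (at_right L)"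
      by (intro tendsto_intros)
    show "\<forall>\<^sub>F K in at_right L. \<bar>v x - v y\<bar> \<le> K * (c * (norm (x - y) + 4 * h * N))"
      using KG[OF that] by (auto simp: eventually_at_filter)
  qed simp
  \<comment> \<open>Inside \<open>\<Omega>\<close> the sequence comes from density of
    \<open>G\<close> and continuity of \<open>u\<close>. Points outside are already admissible, so
    constant sequences do and no continuity of \<open>v\<close> across the boundary is
    invoked.\<close>
  have ex: "\<exists>X. (\<forall>n. X n \<in> G \<union> - \<Omega>) \<and> X \<longlonglongrightarrow> x \<and> (\<lambda>n. v (X n)) \<longlonglongrightarrow> v x" for x
  proof (cases "x \<in> \<Omega>")
    case True
    then have "x \<in> closure G"
      using dense_subset_of_AE[OF assms(2) r(2)] by (auto simp: G_def)
    then obtain X where X: "\<And>n. X n \<in> G" "X \<longlonglongrightarrow> x"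
      unfolding closure_sequential by blast
    then have "(\<lambda>n. u (X n)) \<longlonglongrightarrow> u x"
      using True assms(5) unfolding continuous_on_sequentially by (auto simp: G_def comp_def)
    then have "(\<lambda>n. v (X n)) \<longlonglongrightarrow> v x"
      using X(1) True by (simp add: v_def G_def)
    then show ?thesis using X by blast
  qed (auto intro!: exI[of _ "\<lambda>n. x"])
  obtain X where X: "\<And>n. X n \<in> G \<union> - \<Omega>" "X \<longlonglongrightarrow> x" "(\<lambda>n. v (X n)) \<longlonglongrightarrow> v x"
    using ex[of x] by blast
  obtain Y where Y: "\<And>n. Y n \<in> G \<union> - \<Omega>" "Y \<longlonglongrightarrow> y" "(\<lambda>n. v (Y n)) \<longlonglongrightarrow> v y"
    using ex[of y] by blast
  have "\<bar>v x - v y\<bar> \<le> L * (c * (norm (x - y) + 4 * h * N))"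
  proof (rule LIMSEQ_le)
    show "(\<lambda>n. \<bar>v (X n) - v (Y n)\<bar>) \<longlonglongrightarrow> \<bar>v x - v y\<bar>"
      by (intro tendsto_intros X Y)
    show "(\<lambda>n. L * (c * (norm (X n - Y n) + 4 * h * N))) \<longlonglongrightarrow> L * (c * (norm (x - y) + 4 * h * N))"
      by (intro tendsto_intros X Y)
  qed (use LG[OF X(1) Y(1)] in blast)
  then show ?thesis by (simp add: L_def c_def mult.assoc)
qed

section \<open>The distance to the boundary\<close>

context
  fixes \<Omega> :: "'a::euclidean_space set"
  assumes \<Omega>: "open \<Omega>" "bounded \<Omega>" "\<Omega> \<noteq> {}"
begin

lemma frontier_nonempty: "frontier \<Omega> \<noteq> {}"
  using \<Omega> not_bounded_UNIV by (auto simp: frontier_eq_empty)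

lemma boundary_dist_attained:
  obtains y where "y \<in> frontier \<Omega>" "y \<notin> \<Omega>" "dist x y = boundary_dist \<Omega> x"
proof -
  obtain y where "y \<in> frontier \<Omega>" "infdist x (frontier \<Omega>) = dist x y"
    using infdist_attains_inf[OF frontier_closed frontier_nonempty] by blast
  then show ?thesis
    using \<Omega>(1) by (intro that[of y]) (auto simp: boundary_dist_def frontier_def interior_open)
qed

lemma boundary_dist_lipschitz: "\<bar>boundary_dist \<Omega> x - boundary_dist \<Omega> y\<bar> \<le> dist x y"
  unfolding boundary_dist_def by (rule infdist_triangle_abs)

lemma boundary_dist_nonneg: "boundary_dist \<Omega> x \<ge> 0"
  unfolding boundary_dist_def by (rule infdist_nonneg)

lemma boundary_dist_pos:
  assumes "x \<in> \<Omega>" shows "boundary_dist \<Omega> x > 0"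
proof -
  obtain y where "y \<notin> \<Omega>" "dist x y = boundary_dist \<Omega> x"
    by (rule boundary_dist_attained)
  then show ?thesis using assms by (metis zero_less_dist_iff)
qed

lemma continuous_on_boundary_dist: "continuous_on S (boundary_dist \<Omega>)"
  unfolding boundary_dist_def by (intro continuous_intros)

text \<open>A ball is connected, so if it met both \<open>\<Omega>\<close> and the complement it
  would contain a frontier point closer than the distance to the frontier.\<close>

lemma ball_boundary_dist_subset:
  assumes "x \<in> \<Omega>" shows "ball x (boundary_dist \<Omega> x) \<subseteq> \<Omega>"
proof (rule ccontr)
  assume "\<not> ball x (boundary_dist \<Omega> x) \<subseteq> \<Omega>"
  then have "ball x (boundary_dist \<Omega> x) - \<Omega> \<noteq> {}" by blast
  moreover have "x \<in> ball x (boundary_dist \<Omega> x) \<inter> \<Omega>" using assms boundary_dist_pos by simp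
  then have "ball x (boundary_dist \<Omega> x) \<inter> \<Omega> \<noteq> {}" by blast
  ultimately have "ball x (boundary_dist \<Omega> x) \<inter> frontier \<Omega> \<noteq> {}"
    by (intro connected_Int_frontier connected_ball)
  then obtain y where "y \<in> frontier \<Omega>" "dist x y < boundary_dist \<Omega> x" by auto
  then show False using infdist_le[of y "frontier \<Omega>" x] by (simp add: boundary_dist_def)
qed

lemma boundary_dist_le: "x \<in> \<Omega> \<Longrightarrow> y \<notin> \<Omega> \<Longrightarrow> boundary_dist \<Omega> x \<le> dist x y"
  using ball_boundary_dist_subset[of x] by (force simp: not_less[symmetric])

lemma boundary_dist_bounded:
  obtains R where "R > 0" "\<And>x. x \<in> closure \<Omega> \<Longrightarrow> boundary_dist \<Omega> x \<le> R"
proof -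
  have "compact (boundary_dist \<Omega> ` closure \<Omega>)"
    using \<Omega>(2) continuous_on_boundary_dist by (intro compact_continuous_image) (auto simp: compact_closure)
  then obtain R where "\<And>x. x \<in> closure \<Omega> \<Longrightarrow> \<bar>boundary_dist \<Omega> x\<bar> \<le> R"
    using compact_imp_bounded bounded_real by (metis imageI)
  then show ?thesis by (intro that[of "max 1 R"]) (auto simp: abs_le_iff le_max_iff_disj)
qed

lemma lmeasurable_domain: "\<Omega> \<in> lmeasurable"
  using \<Omega> by (intro bounded_set_imp_lmeasurable) auto

lemma finite_measure_domain: "finite_measure (lebesgue_on \<Omega>)"
  using lmeasurable_domain by (rule finite_measure_lebesgue_on)

lemma integrable_domain_bounded:
  fixes f :: "'a \<Rightarrow> real"
  assumes "f \<in> borel_measurable (lebesgue_on \<Omega>)" "\<And>x. x \<in> \<Omega> \<Longrightarrow> \<bar>f x\<bar> \<le> B"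
  shows "integrable (lebesgue_on \<Omega>) f"
  using assms finite_measure_domain
  by (intro finite_measure.integrable_const_bound[of _ _ B]) auto

lemma continuous_measurable_domain:
  fixes f :: "'a \<Rightarrow> real"
  shows "continuous_on UNIV f \<Longrightarrow> f \<in> borel_measurable (lebesgue_on \<Omega>)"
  using \<Omega>(1) continuous_on_subset[of UNIV f \<Omega>]
  by (intro continuous_imp_measurable_on_sets_lebesgue) auto

text \<open>A constant dominates despite the moving exponent: the base is at most
  \<open>max 1 B\<close>, whose powers increase with the exponent, and \<open>q p\<close> is
  eventually below \<open>r + 1\<close>.\<close>

lemma tendsto_integral_powr:
  fixes w :: "real \<Rightarrow> 'a \<Rightarrow> real" and q :: "real \<Rightarrow> real"
  assumes "\<And>p. w p \<in> borel_measurable (lebesgue_on \<Omega>)" "W \<in> borel_measurable (lebesgue_on \<Omega>)"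
    and ev: "\<forall>\<^sub>F p in at_top. \<forall>x\<in>\<Omega>. 0 \<le> w p x \<and> w p x \<le> B"
    and lim: "\<And>x. x \<in> \<Omega> \<Longrightarrow> ((\<lambda>p. w p x) \<longlongrightarrow> W x) at_top"
    and q: "(q \<longlongrightarrow> r) at_top" "r > 0"
  shows "((\<lambda>p. \<integral>x. w p x powr q p \<partial>lebesgue_on \<Omega>) \<longlongrightarrow> (\<integral>x. W x powr r \<partial>lebesgue_on \<Omega>)) at_top"
proof (rule integral_dominated_convergence_at_top)
  show "integrable (lebesgue_on \<Omega>) (\<lambda>x. max 1 B powr (r + 1))"
    using integrable_domain_bounded[of "\<lambda>x. max 1 B powr (r + 1)" "max 1 B powr (r + 1)"] by simp
  show "AE x in lebesgue_on \<Omega>. ((\<lambda>p. w p x powr q p) \<longlongrightarrow> W x powr r) at_top"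
  proof (rule AE_I2)
    fix x assume "x \<in> space (lebesgue_on \<Omega>)"
    then have x: "x \<in> \<Omega>" by simp
    have "\<forall>\<^sub>F p in at_top. 0 \<le> w p x" using ev x by (auto elim!: eventually_mono)
    then show "((\<lambda>p. w p x powr q p) \<longlongrightarrow> W x powr r) at_top"
      using lim[OF x] q by (intro tendsto_powr') auto
  qed
  have "\<forall>\<^sub>F p in at_top. q p < r + 1" "\<forall>\<^sub>F p in at_top. 0 < q p"
    using order_tendstoD[OF q(1)] q(2) by auto
  with ev show "\<forall>\<^sub>F p in at_top. AE x in lebesgue_on \<Omega>. norm (w p x powr q p) \<le> max 1 B powr (r + 1)"
  proof eventually_elim
    case (elim p)
    have "w p x powr q p \<le> max 1 B powr (r + 1)" if "x \<in> \<Omega>" for x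
    proof -
      have "w p x powr q p \<le> max 1 B powr q p"
        using elim that by (intro powr_mono2) auto
      also have "\<dots> \<le> max 1 B powr (r + 1)"
        using elim by (intro powr_mono) auto
      finally show ?thesis .
    qed
    then show ?case by (intro AE_I2) auto
  qed
qed (use assms in measurable)

lemma integral_boundary_dist_powr_pos: "(\<integral>x. boundary_dist \<Omega> x powr r \<partial>lebesgue_on \<Omega>) > 0"
  if "r \<ge> 0"
proof -
  obtain R where R: "\<And>x. x \<in> closure \<Omega> \<Longrightarrow> boundary_dist \<Omega> x \<le> R"
    using boundary_dist_bounded by metis
  have i: "integrable (lebesgue_on \<Omega>) (\<lambda>x. boundary_dist \<Omega> x powr r)"
  proof (rule integrable_domain_bounded)
    show "(\<lambda>x. boundary_dist \<Omega> x powr r) \<in> borel_measurable (lebesgue_on \<Omega>)"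
      using continuous_measurable_domain[OF continuous_on_boundary_dist] by measurable
    show "\<bar>boundary_dist \<Omega> x powr r\<bar> \<le> R powr r" if "x \<in> \<Omega>" for x
      using R[of x] closure_subset \<open>x \<in> \<Omega>\<close> \<open>r \<ge> 0\<close> boundary_dist_nonneg[of x]
      by (auto intro!: powr_mono2)
  qed
  have "(\<integral>x. boundary_dist \<Omega> x powr r \<partial>lebesgue_on \<Omega>) \<noteq> 0"
  proof
    assume "(\<integral>x. boundary_dist \<Omega> x powr r \<partial>lebesgue_on \<Omega>) = 0"
    then have "AE x in lebesgue_on \<Omega>. boundary_dist \<Omega> x powr r = 0"
      using integral_nonneg_eq_0_iff_AE[OF i] by simp
    then have "\<Omega> \<subseteq> closure {x \<in> \<Omega>. boundary_dist \<Omega> x powr r = 0}"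
      by (rule dense_subset_of_AE[OF \<Omega>(1)])
    also have "{x \<in> \<Omega>. boundary_dist \<Omega> x powr r = 0} = {}"
      using boundary_dist_pos by force
    finally show False using \<Omega>(3) by simp
  qed
  moreover have "(\<integral>x. boundary_dist \<Omega> x powr r \<partial>lebesgue_on \<Omega>) \<ge> 0"
    by (intro integral_nonneg_AE) simp
  ultimately show ?thesis by linarith
qed

end

text \<open>The difference quotient in the direction of the gradient itself tends to the squared
  norm of the gradient and is at most \<open>L\<close> times that norm.\<close>

lemma norm_grad_le_lipschitz:
  assumes "smooth_fun g" "\<And>x y. \<bar>g x - g y\<bar> \<le> L * dist x y" "L \<ge> 0"
  shows "norm (grad g x) \<le> L"
proof (cases "grad g x = 0")
  case False
  let ?h = "grad g x"
  have "((\<lambda>t. x + t *\<^sub>R ?h) has_derivative (\<lambda>t. t *\<^sub>R ?h)) (at 0)"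
    by (auto intro!: derivative_eq_intros)
  from has_derivative_compose[OF this smooth_fun_has_derivative_grad[OF assms(1)]]
  have "((\<lambda>t. g (x + t *\<^sub>R ?h)) has_real_derivative ?h \<bullet> ?h) (at 0)"
    by (simp add: has_field_derivative_def mult_commute_abs)
  then have "((\<lambda>t. (g (x + t *\<^sub>R ?h) - g x) / t) \<longlongrightarrow> ?h \<bullet> ?h) (at 0)"
    by (simp add: DERIV_def)
  moreover have "(g (x + t *\<^sub>R ?h) - g x) / t \<le> L * norm ?h" if "t \<noteq> 0" for t
  proof -
    have "\<bar>g (x + t *\<^sub>R ?h) - g x\<bar> / \<bar>t\<bar> \<le> (L * (\<bar>t\<bar> * norm ?h)) / \<bar>t\<bar>"
      using assms(2)[of "x + t *\<^sub>R ?h" x] by (intro divide_right_mono) (auto simp: dist_norm)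
    then have "\<bar>(g (x + t *\<^sub>R ?h) - g x) / t\<bar> \<le> L * norm ?h"
      using that by simp
    then show ?thesis by linarith
  qed
  ultimately have "?h \<bullet> ?h \<le> L * norm ?h"
    by (intro tendsto_upperbound[of _ _ "at 0"]) (auto simp: eventually_at_filter)
  then show ?thesis
    using False by (simp add: dot_square_norm power2_eq_square)
qed (use assms in simp)

section \<open>Bounds for the Sobolev constant\<close>

lemma Lp_norm_nonneg: "Lp_norm p \<Omega> f \<ge> 0"
  by (simp add: Lp_norm_def)

lemma sobolev_const_nonneg:
  assumes "u \<in> sobolev_space_0 p \<Omega>" "Lp_norm q \<Omega> u = 1"
  shows "sobolev_const \<Omega> p q \<ge> 0"
  unfolding sobolev_const_def using assms by (intro cInf_greatest) auto

lemma sobolev_const_le: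
  assumes "u \<in> sobolev_space_0 p \<Omega>" "Lp_norm q \<Omega> u = 1"
  shows "sobolev_const \<Omega> p q \<le> Lp_norm p \<Omega> (weak_gradient \<Omega> u) powr p"
  unfolding sobolev_const_def using assms by (intro cInf_lower bdd_belowI[of _ 0]) auto

text \<open>The competitor has gradient at most 1 / J everywhere, so its p-energy is at most the
  volume of \<open>\<Omega>\<close> times J^(-p); the volume factor disappears under the p-th root
  as p grows.\<close>

lemma sobolev_const_upper_bound:
  fixes \<Omega> :: "'a::euclidean_space set"
  assumes \<Omega>: "open \<Omega>" "bounded \<Omega>" "\<Omega> \<noteq> {}" and "\<epsilon> > 0" "p \<ge> 1" "q \<ge> 1"
  defines "I \<equiv> (\<integral>x. max 0 (boundary_dist \<Omega> x - 3 * \<epsilon>) powr q \<partial>lebesgue_on \<Omega>)"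
  assumes "I > 0"
  shows "sobolev_const \<Omega> p q powr (1 / p) \<le> measure lebesgue \<Omega> powr (1 / p) / I powr (1 / q)"
proof -
  note d = boundary_dist_lipschitz[OF \<Omega>] boundary_dist_nonneg[OF \<Omega>] ball_boundary_dist_subset[OF \<Omega>]
    boundary_dist_le[OF \<Omega>]
  \<comment> \<open>Mollifying at radius \<open>\<epsilon>\<close> costs \<open>\<epsilon>\<close>
    twice: in the support, which therefore stays where the distance exceeds
    \<open>\<epsilon>\<close>, and in height, which explains the 3 \<open>\<epsilon>\<close> in
    \<open>I\<close>. The case distinction matters because \<open>boundary_dist\<close> grows again
    outside the closure of \<open>\<Omega>\<close>.\<close>
  define F where "F x = (if x \<in> \<Omega> then max 0 (boundary_dist \<Omega> x - 2 * \<epsilon>) else 0)" for x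
  have lipF: "\<bar>F x - F y\<bar> \<le> 1 * dist x y" for x y
  proof -
    have "\<bar>F x - F y\<bar> \<le> dist x y" if "x \<in> \<Omega>" for x y
      using that d(1)[of x y] d(4)[of x y] \<open>\<epsilon> > 0\<close> by (auto simp: F_def max_def)
    from this[of x y] this[of y x] show ?thesis
      by (cases "x \<in> \<Omega>"; cases "y \<in> \<Omega>") (auto simp: F_def dist_commute abs_minus_commute)
  qed
  have cF: "continuous_on UNIV F"
    unfolding continuous_on_iff using lipF by (auto simp: dist_real_def intro: le_less_trans)
  define K where "K = closure \<Omega> \<inter> {x. \<epsilon> \<le> boundary_dist \<Omega> x}"
  have K: "compact K"
    unfolding K_def using \<Omega>(2) continuous_on_boundary_dist[OF \<Omega>]
    by (intro compact_Int_closed closed_Collect_le) (auto simp: compact_closure)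
  have K\<Omega>: "K \<subseteq> \<Omega>"
  proof
    fix x assume x: "x \<in> K"
    show "x \<in> \<Omega>"
    proof (rule ccontr)
      assume "x \<notin> \<Omega>"
      then have "x \<in> frontier \<Omega>" using x \<Omega>(1) by (auto simp: K_def frontier_def interior_open)
      then show False using x \<open>\<epsilon> > 0\<close> by (auto simp: K_def boundary_dist_def)
    qed
  qed
  have FK: "x \<in> K" if "F x \<noteq> 0" for x
    using that \<open>\<epsilon> > 0\<close> closure_subset by (auto simp: F_def K_def max_def split: if_splits)
  obtain g where g: "smooth_fun g" "\<And>x. g x \<noteq> 0 \<Longrightarrow> \<exists>y. F y \<noteq> 0 \<and> dist x y < \<epsilon>"
    "\<And>x e. (\<And>y. dist x y < \<epsilon> \<Longrightarrow> \<bar>F y - F x\<bar> \<le> e) \<Longrightarrow> \<bar>g x - F x\<bar> \<le> e"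
    "\<And>L x y. (\<And>x y. \<bar>F x - F y\<bar> \<le> L * dist x y) \<Longrightarrow> \<bar>g x - g y\<bar> \<le> L * dist x y"
    using mollification_exists[OF cF K FK \<open>\<epsilon> > 0\<close>] by blast
  have gF: "\<bar>g x - F x\<bar> \<le> \<epsilon>" for x
  proof (rule g(3))
    show "\<bar>F y - F x\<bar> \<le> \<epsilon>" if "dist x y < \<epsilon>" for y
      using lipF[of y x] that by (simp add: dist_commute)
  qed
  have gK: "x \<in> K" if gx: "g x \<noteq> 0" for x
  proof -
    obtain y where y: "F y \<noteq> 0" "dist x y < \<epsilon>" using g(2)[OF gx] by blast
    then have y': "y \<in> \<Omega>" "boundary_dist \<Omega> y > 2 * \<epsilon>"
      by (auto simp: F_def max_def split: if_splits)
    then have "x \<in> \<Omega>"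
      using d(4)[of y x] y(2) \<open>\<epsilon> > 0\<close> by (force simp: dist_commute)
    then show ?thesis
      using y y' d(1)[of x y] closure_subset by (auto simp: K_def)
  qed
  have g_test: "g \<in> test_functions \<Omega>"
    using test_functionsI[OF g(1) K K\<Omega> gK] .
  have "q > 0" "p > 0" using assms by auto
  define J where "J = Lp_norm q \<Omega> g"
  have gLq: "g \<in> Lp_space q \<Omega>"
    using test_function_in_Lp_space[OF \<Omega>(1) g_test \<open>q > 0\<close>] .
  have "I \<le> (\<integral>x. norm (g x) powr q \<partial>lebesgue_on \<Omega>)"
    unfolding I_def
  proof (rule integral_mono)
    obtain R where R: "\<And>x. x \<in> closure \<Omega> \<Longrightarrow> boundary_dist \<Omega> x \<le> R" "R > 0"
      using boundary_dist_bounded[OF \<Omega>] by metis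
    show "integrable (lebesgue_on \<Omega>) (\<lambda>x. max 0 (boundary_dist \<Omega> x - 3 * \<epsilon>) powr q)"
    proof (rule integrable_domain_bounded[OF \<Omega>])
      show "(\<lambda>x. max 0 (boundary_dist \<Omega> x - 3 * \<epsilon>) powr q) \<in> borel_measurable (lebesgue_on \<Omega>)"
        using continuous_measurable_domain[OF \<Omega> continuous_on_boundary_dist[OF \<Omega>]] by measurable
      show "\<bar>max 0 (boundary_dist \<Omega> x - 3 * \<epsilon>) powr q\<bar> \<le> R powr q" if "x \<in> \<Omega>" for x
      proof -
        have "boundary_dist \<Omega> x \<le> R" using R(1) closure_subset[of \<Omega>] that by blast
        then have "max 0 (boundary_dist \<Omega> x - 3 * \<epsilon>) powr q \<le> R powr q"
          using R(2) \<open>q > 0\<close> \<open>\<epsilon> > 0\<close> by (intro powr_mono2) auto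
        then show ?thesis by simp
      qed
    qed
    show "integrable (lebesgue_on \<Omega>) (\<lambda>x. norm (g x) powr q)"
      using gLq by (simp add: Lp_space_def)
    show "max 0 (boundary_dist \<Omega> x - 3 * \<epsilon>) powr q \<le> norm (g x) powr q"
      if "x \<in> space (lebesgue_on \<Omega>)" for x
      using that gF[of x] \<open>q > 0\<close> \<open>\<epsilon> > 0\<close> by (intro powr_mono2) (auto simp: F_def)
  qed
  then have IJ: "I powr (1 / q) \<le> J"
    using gLq \<open>I > 0\<close> \<open>q > 0\<close> by (auto simp: J_def Lp_norm_def intro!: powr_mono2)
  have J: "J > 0"
    using IJ \<open>I > 0\<close> by (intro less_le_trans[OF _ IJ]) simp
  define v where "v = (\<lambda>x. (1 / J) * g x)"
  have v: "v \<in> test_functions \<Omega>"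
    unfolding v_def using test_function_cmult[OF g_test] .
  have vLq: "Lp_norm q \<Omega> v = 1"
  proof -
    have "(\<integral>x. norm (v x) powr q \<partial>lebesgue_on \<Omega>) = (\<integral>x. (1 / J) powr q * norm (g x) powr q \<partial>lebesgue_on \<Omega>)"
      using J by (intro Bochner_Integration.integral_cong) (auto simp: v_def powr_divide)
    also have "\<dots> = (1 / J) powr q * J powr q"
      using Lp_norm_powr[OF gLq \<open>q > 0\<close>] by (simp add: J_def)
    also have "\<dots> = 1" using J by (simp add: powr_mult[symmetric])
    finally show ?thesis
      using test_function_in_Lp_space[OF \<Omega>(1) v \<open>q > 0\<close>] by (simp add: Lp_norm_def)
  qed
  have gv: "norm (grad v x) \<le> 1 / J" for x
  proof -
    have "norm (grad g x) \<le> 1" using g(4)[OF lipF] by (intro norm_grad_le_lipschitz[OF g(1)]) auto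
    then show ?thesis
      unfolding v_def grad_cmult[OF g(1)] using J by (simp add: divide_right_mono)
  qed
  have v0: "v \<in> sobolev_space_0 p \<Omega>"
    using test_function_in_sobolev_space_0[OF \<Omega>(1) v \<open>p > 0\<close>] .
  have gvL: "grad v \<in> Lp_space p \<Omega>"
    using grad_test_function_in_Lp_space[OF \<Omega>(1) v \<open>p > 0\<close>] .
  have "sobolev_const \<Omega> p q \<le> Lp_norm p \<Omega> (weak_gradient \<Omega> v) powr p"
    using sobolev_const_le[OF v0 vLq] .
  also have "\<dots> = (\<integral>x. norm (grad v x) powr p \<partial>lebesgue_on \<Omega>)"
    using Lp_norm_powr[OF gvL \<open>p > 0\<close>]
    by (simp add: Lp_norm_weak_gradient[OF \<Omega>(1) test_function_has_weak_gradient[OF \<Omega>(1) v]])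
  also have "\<dots> \<le> (\<integral>x. (1 / J) powr p \<partial>lebesgue_on \<Omega>)"
    using gvL gv \<open>p > 0\<close> integrable_domain_bounded[OF \<Omega>, of "\<lambda>x. (1 / J) powr p" "(1 / J) powr p"]
    by (intro integral_mono) (auto simp: Lp_space_def intro!: powr_mono2)
  also have "\<dots> = measure lebesgue \<Omega> * (1 / J) powr p"
    using \<Omega>(1) by (simp add: measure_restrict_space)
  finally have "sobolev_const \<Omega> p q powr (1 / p) \<le> (measure lebesgue \<Omega> * (1 / J) powr p) powr (1 / p)"
    using \<open>p > 0\<close> by (intro powr_mono2 sobolev_const_nonneg[OF v0 vLq]) auto
  also have "\<dots> = measure lebesgue \<Omega> powr (1 / p) / J"
    using J \<open>p > 0\<close> by (simp add: powr_mult powr_powr)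
  also have "\<dots> \<le> measure lebesgue \<Omega> powr (1 / p) / I powr (1 / q)"
    using IJ \<open>I > 0\<close> J by (intro divide_left_mono) auto
  finally show ?thesis .
qed

text \<open>After dividing by a + b both terms lie in [0, 1], where raising the exponent from 1 to
  \<open>q\<close> decreases values. It later turns a pointwise gap into a gap between q-th
  powers.\<close>

lemma powr_superadditive:
  fixes a b q :: real
  assumes "a \<ge> 0" "b \<ge> 0" "q \<ge> 1"
  shows "a powr q + b powr q \<le> (a + b) powr q"
proof (cases "a + b = 0")
  case False
  then have c: "a + b > 0" using assms by simp
  have "(a / (a + b)) powr q + (b / (a + b)) powr q \<le> (a / (a + b)) powr 1 + (b / (a + b)) powr 1"
    using assms c by (intro add_mono powr_mono') auto
  also have "\<dots> = 1" using assms c by (simp add: add_divide_distrib[symmetric])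
  finally have "(a powr q + b powr q) / (a + b) powr q \<le> 1"
    using assms c by (simp add: powr_divide add_divide_distrib)
  then show ?thesis using c by (simp add: pos_divide_le_eq)
qed (use assms in \<open>simp add: add_nonneg_eq_0_iff\<close>)

section \<open>The limit\<close>

theorem proposition1p5:
  fixes \<Omega> :: "'a::euclidean_space set" and q :: "real \<Rightarrow> real"
    and u :: "real \<Rightarrow> 'a \<Rightarrow> real" and r :: real
  assumes "DIM('a) \<ge> 2"
    and "bounded_smooth_domain \<Omega>"
    and "\<And>p. p > real DIM('a) \<Longrightarrow> q p \<ge> 1"
    and "\<And>p. p > real DIM('a) \<Longrightarrow> sobolev_extremal \<Omega> p (q p) (u p)"
    and "(q \<longlongrightarrow> r) at_top"
  shows "((\<lambda>p. sobolev_const \<Omega> p (q p) powr (1 / p)) \<longlongrightarrow>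
             inverse (Lp_norm r \<Omega> (boundary_dist \<Omega>))) at_top \<and>
         uniform_limit (closure \<Omega>) u
           (\<lambda>x. boundary_dist \<Omega> x / Lp_norm r \<Omega> (boundary_dist \<Omega>)) at_top"
proof -

  \<comment> \<open>Setting and the range of exponents\<close>
  define N where "N = real DIM('a)"
  have N: "N \<ge> 1" using DIM_positive[where 'a = 'a] by (simp add: N_def Suc_leI)
  have \<Omega>: "open \<Omega>" "bounded \<Omega>" "\<Omega> \<noteq> {}"
    using assms(2) by (auto simp: bounded_smooth_domain_def)
  let ?M = "lebesgue_on \<Omega>"
  define d where "d = boundary_dist \<Omega>"
  have d0: "d x \<ge> 0" for x unfolding d_def by (rule boundary_dist_nonneg[OF \<Omega>])
  have dlip: "\<bar>d x - d y\<bar> \<le> dist x y" for x y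
    unfolding d_def by (rule boundary_dist_lipschitz[OF \<Omega>])
  have dm: "d \<in> borel_measurable ?M"
    unfolding d_def by (intro continuous_measurable_domain[OF \<Omega>] continuous_on_boundary_dist[OF \<Omega>])
  obtain R where R: "R > 0" "\<And>x. x \<in> closure \<Omega> \<Longrightarrow> d x \<le> R"
    unfolding d_def using boundary_dist_bounded[OF \<Omega>] by blast
  have R': "d x \<le> R" if "x \<in> \<Omega>" for x
    using R(2) that closure_subset by blast
  \<comment> \<open>The threshold 2 N is the one under which the Morrey estimate is
    available.\<close>
  have big: "\<forall>\<^sub>F p in at_top. p \<ge> 2 * N \<and> p > N \<and> p \<ge> 1"
    using eventually_ge_at_top[of "2 * N"] by eventually_elim (use N in auto)
  have r: "r \<ge> 1"
  proof (rule tendsto_lowerbound[OF assms(5)])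
    show "\<forall>\<^sub>F p in at_top. 1 \<le> q p"
      using big assms(3) by (auto elim!: eventually_mono simp: N_def)
  qed simp
  then have r0: "r > 0" by simp

  \<comment> \<open>The limiting norm of the distance function\<close>
  define D where "D = (\<integral>x. d x powr r \<partial>?M) powr (1 / r)"
  have Dpos: "(\<integral>x. d x powr r \<partial>?M) > 0"
    unfolding d_def using integral_boundary_dist_powr_pos[OF \<Omega>] r0 by simp
  then have D: "D > 0" by (simp add: D_def)
  have D_eq: "Lp_norm r \<Omega> d = D"
  proof -
    have "integrable ?M (\<lambda>x. d x powr r)"
    proof (rule integrable_domain_bounded[OF \<Omega>])
      show "\<bar>d x powr r\<bar> \<le> R powr r" if "x \<in> \<Omega>" for x
        using R'[OF that] d0[of x] r0 by (auto intro!: powr_mono2)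
    qed (use dm in measurable)
    then show ?thesis using dm d0 by (simp add: Lp_norm_def Lp_space_def D_def)
  qed

  \<comment> \<open>Constants of the Morrey bound and their limits\<close>
  define Lam where "Lam p = sobolev_const \<Omega> p (q p) powr (1 / p)" for p
  \<comment> \<open>\<open>C\<close> and \<open>e\<close> are the factor and the additive error of
    the Morrey estimate for h = 1/p. Since \<open>C p\<close> is exp of N (ln p - ln 2) / p, this
    \<open>h\<close> shrinks slowly enough for \<open>C\<close> to tend to 1.\<close>
  define C where "C p = (2 * (1 / p)) powr (- N / p)" for p
  define e where "e p = 4 * (1 / p) * N" for p
  have lim0: "((\<lambda>p::real. 1 / p) \<longlongrightarrow> 0) at_top"
    by (rule tendsto_divide_0[OF tendsto_const filterlim_at_top_imp_at_infinity[OF filterlim_ident]])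
  have Clim: "(C \<longlongrightarrow> 1) at_top"
  proof (rule Lim_transform_eventually)
    have "((\<lambda>p. exp (N * (ln p / p) - N * ln 2 * (1 / p))) \<longlongrightarrow> exp (N * 0 - N * ln 2 * 0)) at_top"
      by (intro tendsto_intros lim0 ln_x_over_x_tendsto_0)
    then show "((\<lambda>p. exp (N * (ln p / p) - N * ln 2 * (1 / p))) \<longlongrightarrow> 1) at_top" by simp
    show "\<forall>\<^sub>F p in at_top. exp (N * (ln p / p) - N * ln 2 * (1 / p)) = C p"
      using eventually_gt_at_top[of 0]
      by eventually_elim (simp add: C_def powr_def ln_div field_simps)
  qed
  have e_lim: "(e \<longlongrightarrow> 0) at_top"
    unfolding e_def using tendsto_mult[OF tendsto_mult[OF tendsto_const[of 4] lim0] tendsto_const[of N]] by simp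
  define m where "m p = Lam p * C p" for p
  have m0: "m p \<ge> 0" for p by (simp add: m_def Lam_def C_def)

  \<comment> \<open>Pointwise bounds for the extremals\<close>
  have ext: "(\<integral>x. u p x powr q p \<partial>?M) = 1 \<and> integrable ?M (\<lambda>x. u p x powr q p) \<and> (\<forall>x\<in>\<Omega>. u p x > 0)
      \<and> continuous_on (closure \<Omega>) (u p)
      \<and> (\<forall>x\<in>\<Omega>. \<forall>y\<in>\<Omega>. \<bar>u p x - u p y\<bar> \<le> m p * (dist x y + e p))
      \<and> (\<forall>x\<in>\<Omega>. u p x \<le> m p * (d x + e p))" if p: "p \<ge> 2 * N \<and> p > N \<and> p \<ge> 1" for p
  proof -
    have q1: "q p \<ge> 1" using assms(3) p by (simp add: N_def)
    have u: "u p \<in> sobolev_space_0 p \<Omega>" "continuous_on (closure \<Omega>) (u p)" "\<And>x. x \<in> \<Omega> \<Longrightarrow> u p x > 0"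
        "Lp_norm (q p) \<Omega> (u p) = 1" "Lp_norm p \<Omega> (weak_gradient \<Omega> (u p)) powr p = sobolev_const \<Omega> p (q p)"
      using assms(4)[of p] p by (auto simp: N_def sobolev_extremal_def)
    have L: "Lp_norm p \<Omega> (weak_gradient \<Omega> (u p)) = Lam p"
      using p u(5)[symmetric] by (simp add: Lam_def powr_powr Lp_norm_nonneg)
    have uL: "u p \<in> Lp_space (q p) \<Omega>"
      using u(4) by (auto simp: Lp_norm_def split: if_splits)
    have ab: "\<bar>u p x\<bar> = u p x" if "x \<in> space ?M" for x
      using u(3)[of x] that by simp
    have "(\<integral>x. norm (u p x) powr q p \<partial>?M) = 1"
      using Lp_norm_powr[OF uL] q1 u(4) by simp
    also have "(\<integral>x. norm (u p x) powr q p \<partial>?M) = (\<integral>x. u p x powr q p \<partial>?M)"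
      using ab by (intro Bochner_Integration.integral_cong) auto
    finally have int: "(\<integral>x. u p x powr q p \<partial>?M) = 1" .
    \<comment> \<open>A nonintegrable function has integral 0 by default, so a nonzero integral
      certifies integrability.\<close>
    then have "integrable ?M (\<lambda>x. u p x powr q p)"
      by (metis not_integrable_integral_eq zero_neq_one)
    moreover have mor: "\<bar>(if x \<in> \<Omega> then u p x else 0) - (if y \<in> \<Omega> then u p y else 0)\<bar> \<le> m p * (dist x y + e p)" for x y
      using morrey_sobolev_space_0[OF \<Omega>(1) _ u(1) continuous_on_subset[OF u(2) closure_subset], of "1 / p" x y]
        p N by (simp add: N_def L m_def C_def e_def dist_norm)
    have "u p x \<le> m p * (d x + e p)" if x: "x \<in> \<Omega>" for x
    proof -
      \<comment> \<open>At a nearest boundary point the extension by zero vanishes, so the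
        difference bound becomes a bound for \<open>u p x\<close> alone.\<close>
      obtain y where "y \<notin> \<Omega>" "dist x y = d x"
        unfolding d_def by (rule boundary_dist_attained[OF \<Omega>])
      then show ?thesis using mor[of x y] x by simp
    qed
    moreover have "\<bar>u p x - u p y\<bar> \<le> m p * (dist x y + e p)" if "x \<in> \<Omega>" "y \<in> \<Omega>" for x y
      using mor[of x y] that by simp
    ultimately show ?thesis using int u(2,3) by blast
  qed

  \<comment> \<open>Norms of the perturbed distance functions\<close>
  have limA: "((\<lambda>p. \<integral>x. (d x + e p) powr q p \<partial>?M) \<longlongrightarrow> (\<integral>x. d x powr r \<partial>?M)) at_top"
  proof (rule tendsto_integral_powr[OF \<Omega> _ dm _ _ assms(5) r0])
    have "\<forall>\<^sub>F p in at_top. e p < 1" using order_tendstoD(2)[OF e_lim, of 1] by simp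
    with big show "\<forall>\<^sub>F p in at_top. \<forall>x\<in>\<Omega>. 0 \<le> d x + e p \<and> d x + e p \<le> R + 1"
    proof eventually_elim
      case (elim p)
      then have "e p \<ge> 0" using N by (simp add: e_def)
      then have "0 \<le> d x + e p \<and> d x + e p \<le> R + 1" if "x \<in> \<Omega>" for x
        using elim(2) R'[OF that] d0[of x] by linarith
      then show ?case by blast
    qed
    show "((\<lambda>p. d x + e p) \<longlongrightarrow> d x) at_top" for x
      using tendsto_add[OF tendsto_const e_lim] by simp
    show "(\<lambda>x. d x + e p) \<in> borel_measurable ?M" for p
      by (intro borel_measurable_add dm borel_measurable_const)
  qed
  have limB: "((\<lambda>p. \<integral>x. max 0 (d x - 3 * (1 / p)) powr q p \<partial>?M) \<longlongrightarrow> (\<integral>x. d x powr r \<partial>?M)) at_top"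
  proof (rule tendsto_integral_powr[OF \<Omega> _ dm _ _ assms(5) r0])
    show "\<forall>\<^sub>F p in at_top. \<forall>x\<in>\<Omega>. 0 \<le> max 0 (d x - 3 * (1 / p)) \<and> max 0 (d x - 3 * (1 / p)) \<le> R"
      using eventually_gt_at_top[of 0]
    proof eventually_elim
      case (elim p)
      then have "1 / p \<ge> 0" by simp
      then have "0 \<le> max 0 (d x - 3 * (1 / p)) \<and> max 0 (d x - 3 * (1 / p)) \<le> R" if "x \<in> \<Omega>" for x
        using R'[OF that] R(1) by linarith
      then show ?case by blast
    qed
    have "((\<lambda>p. max 0 (d x - 3 * (1 / p))) \<longlongrightarrow> max 0 (d x - 3 * 0)) at_top" for x
      by (intro tendsto_max tendsto_diff tendsto_mult tendsto_const lim0)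
    then show "((\<lambda>p. max 0 (d x - 3 * (1 / p))) \<longlongrightarrow> d x) at_top" for x
      using d0 by (simp add: max_absorb2)
    show "(\<lambda>x. max 0 (d x - 3 * (1 / p))) \<in> borel_measurable ?M" for p
      by (intro borel_measurable_max borel_measurable_diff dm borel_measurable_const)
  qed
  define A where "A p = (\<integral>x. (d x + e p) powr q p \<partial>?M) powr (1 / q p)" for p
  define B where "B p = (\<integral>x. max 0 (d x - 3 * (1 / p)) powr q p \<partial>?M) powr (1 / q p)" for p
  have inv_q: "((\<lambda>p. 1 / q p) \<longlongrightarrow> 1 / r) at_top"
    using assms(5) r0 by (intro tendsto_intros) auto
  have AD: "(A \<longlongrightarrow> D) at_top"
    unfolding A_def D_def using Dpos by (intro tendsto_powr limA inv_q) auto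
  have BD: "(B \<longlongrightarrow> D) at_top"
    unfolding B_def D_def using Dpos by (intro tendsto_powr limB inv_q) auto

  \<comment> \<open>Two-sided bounds for the Sobolev constant\<close>
  have lower: "\<forall>\<^sub>F p in at_top. 1 / (C p * A p) \<le> Lam p"
    using big order_tendstoD(1)[OF AD D] order_tendstoD(1)[OF Clim, of 0, simplified]
      order_tendstoD(1)[OF limA Dpos]
  proof eventually_elim
    case (elim p)
    have q1: "q p \<ge> 1" using assms(3) elim by (simp add: N_def)
    have e0: "e p \<ge> 0" using elim N by (simp add: e_def)
    note E = ext[OF elim(1)]
    have i: "integrable ?M (\<lambda>x. (d x + e p) powr q p)"
      using elim(4) by (metis not_integrable_integral_eq less_irrefl)
    have "1 = (\<integral>x. u p x powr q p \<partial>?M)" using E by simp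
    also have "\<dots> \<le> (\<integral>x. m p powr q p * (d x + e p) powr q p \<partial>?M)"
    proof (rule integral_mono)
      fix x assume "x \<in> space ?M"
      then have x: "x \<in> \<Omega>" by simp
      have "0 \<le> u p x" "u p x \<le> m p * (d x + e p)" using E x by (auto intro: less_imp_le)
      then have "u p x powr q p \<le> (m p * (d x + e p)) powr q p"
        using q1 by (intro powr_mono2) auto
      then show "u p x powr q p \<le> m p powr q p * (d x + e p) powr q p"
        using m0 d0 e0 by (simp add: powr_mult)
    qed (use E i in auto)
    also have "\<dots> = m p powr q p * (\<integral>x. (d x + e p) powr q p \<partial>?M)" by simp
    finally have "1 powr (1 / q p) \<le> (m p powr q p * (\<integral>x. (d x + e p) powr q p \<partial>?M)) powr (1 / q p)"
      using q1 by (intro powr_mono2) auto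
    then have "1 \<le> m p * A p"
      using q1 m0 elim(4) by (simp add: powr_mult powr_powr A_def)
    then show ?case using elim by (simp add: m_def field_simps)
  qed
  have upper: "\<forall>\<^sub>F p in at_top. Lam p \<le> measure lebesgue \<Omega> powr (1 / p) / B p"
    using big order_tendstoD(1)[OF limB Dpos]
  proof eventually_elim
    case (elim p)
    then show ?case
      unfolding Lam_def B_def d_def
      \<comment> \<open>The instance \<open>\<epsilon>\<close> = 1/p produces exactly the shift 3/p
        in \<open>B\<close>.\<close>
      using assms(3)[of p] by (intro sobolev_const_upper_bound[OF \<Omega>]) (auto simp: N_def)
  qed
  \<comment> \<open>Needed for the p-th root of the volume to tend to 1, since
    \<open>0 powr 0\<close> is 0.\<close>
  have "measure lebesgue \<Omega> > 0"
    using open_not_negligible[OF \<Omega>(1,3)] lmeasurable_domain[OF \<Omega>]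
    by (metis negligible_iff_measure0 zero_less_measure_iff)
  then have "((\<lambda>p. measure lebesgue \<Omega> powr (1 / p)) \<longlongrightarrow> measure lebesgue \<Omega> powr 0) at_top"
    by (intro tendsto_powr tendsto_const lim0) auto
  then have up_lim: "((\<lambda>p. measure lebesgue \<Omega> powr (1 / p) / B p) \<longlongrightarrow> 1 / D) at_top"
    using tendsto_divide[OF _ BD] D \<open>measure lebesgue \<Omega> > 0\<close> by fastforce
  have "((\<lambda>p. 1 / (C p * A p)) \<longlongrightarrow> 1 / (1 * D)) at_top"
    using D by (intro tendsto_intros Clim AD) auto
  then have lo_lim: "((\<lambda>p. 1 / (C p * A p)) \<longlongrightarrow> 1 / D) at_top" by simp
  have Lam_lim: "(Lam \<longlongrightarrow> 1 / D) at_top"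
    by (rule tendsto_sandwich[OF lower upper lo_lim up_lim])
  have m_lim: "(m \<longlongrightarrow> 1 / D) at_top"
    unfolding m_def using tendsto_mult[OF Lam_lim Clim] by simp

  \<comment> \<open>Uniform convergence by the gap argument\<close>
  have "uniform_limit (closure \<Omega>) u (\<lambda>x. d x / D) at_top"
    unfolding uniform_limit_iff
  proof (intro allI impI)
    fix \<delta> :: real assume "\<delta> > 0"
    \<comment> \<open>Passing from \<open>\<Omega>\<close> to its closure preserves only a weak
      inequality, so a smaller tolerance is used inside.\<close>
    define \<eta> where "\<eta> = \<delta> / 2"
    have \<eta>: "\<eta> > 0" "\<eta> < \<delta>" using \<open>\<delta> > 0\<close> by (auto simp: \<eta>_def)
    \<comment> \<open>As \<open>m p\<close> tends to 1/D, the loss 2 \<open>m p\<close>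
      \<open>\<rho>\<close> over a ball of this radius tends to \<open>\<eta>\<close> / 2, leaving a
      gap above \<open>\<eta>\<close> / 4.\<close>
    define \<rho> where "\<rho> = \<eta> * D / 4"
    have \<rho>: "\<rho> > 0" using \<eta> D by (simp add: \<rho>_def)
    \<comment> \<open>The volume of the ball is the same for every centre, which makes the
      contradiction uniform in the point.\<close>
    define \<kappa> where "\<kappa> = measure lborel (ball (0::'a) \<rho>)"
    have ball_\<kappa>: "measure lebesgue (ball x \<rho>) = \<kappa>" for x :: 'a
    proof -
      have "measure lebesgue (ball x \<rho>) = measure lborel (ball x \<rho>)" by simp
      also have "\<dots> = \<kappa>"
        unfolding \<kappa>_def using \<rho>
        by (intro trans[OF content_ball_conv_unit_ball content_ball_conv_unit_ball[symmetric]]) auto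
      finally show ?thesis .
    qed
    have \<kappa>: "\<kappa> > 0" unfolding \<kappa>_def using \<rho> content_ball_pos by blast
    have ev1: "\<forall>\<^sub>F p in at_top. \<bar>m p - 1 / D\<bar> * R + m p * e p < \<eta>"
    proof (rule order_tendstoD(2))
      show "((\<lambda>p. \<bar>m p - 1 / D\<bar> * R + m p * e p) \<longlongrightarrow> \<bar>1 / D - 1 / D\<bar> * R + 1 / D * 0) at_top"
        by (intro tendsto_add tendsto_mult tendsto_rabs tendsto_diff tendsto_const m_lim e_lim)
    qed (use \<eta> in simp)
    have ev2: "\<forall>\<^sub>F p in at_top. \<eta> - \<bar>m p - 1 / D\<bar> * R - 2 * m p * \<rho> > \<eta> / 4"
    proof (rule order_tendstoD(1))
      show "((\<lambda>p. \<eta> - \<bar>m p - 1 / D\<bar> * R - 2 * m p * \<rho>) \<longlongrightarrow>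
          \<eta> - \<bar>1 / D - 1 / D\<bar> * R - 2 * (1 / D) * \<rho>) at_top"
        by (intro tendsto_mult tendsto_rabs tendsto_diff tendsto_const m_lim)
    qed (use \<eta> D in \<open>simp add: \<rho>_def\<close>)
    have "((\<lambda>p. m p powr q p * (\<integral>x. (d x + e p) powr q p \<partial>?M) - (\<eta> / 4) powr q p * \<kappa>) \<longlongrightarrow>
        (1 / D) powr r * (\<integral>x. d x powr r \<partial>?M) - (\<eta> / 4) powr r * \<kappa>) at_top"
      using D \<eta>
      by (intro tendsto_diff tendsto_mult tendsto_powr tendsto_const m_lim limA assms(5)) auto
    moreover have "(1 / D) powr r * (\<integral>x. d x powr r \<partial>?M) = 1"
    proof -
      have "D powr r = (\<integral>x. d x powr r \<partial>?M)"
        using Dpos r0 by (simp add: D_def powr_powr)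
      then show ?thesis using D Dpos by (simp add: powr_divide)
    qed
    ultimately have ev3_lim: "((\<lambda>p. m p powr q p * (\<integral>x. (d x + e p) powr q p \<partial>?M) - (\<eta> / 4) powr q p * \<kappa>)
        \<longlongrightarrow> 1 - (\<eta> / 4) powr r * \<kappa>) at_top"
      by (simp only:)
    \<comment> \<open>The norm budget: the dominating function has q-th power integral tending to 1,
      so it eventually cannot exceed the integral 1 of the extremal by the fixed amount that a gap
      would contribute.\<close>
    have ev3: "\<forall>\<^sub>F p in at_top.
        m p powr q p * (\<integral>x. (d x + e p) powr q p \<partial>?M) - (\<eta> / 4) powr q p * \<kappa> < 1"
      by (rule order_tendstoD(2)[OF ev3_lim]) (use \<kappa> \<eta> in simp)
    show "\<forall>\<^sub>F p in at_top. \<forall>x\<in>closure \<Omega>. dist (u p x) (d x / D) < \<delta>"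
      using big ev1 ev2 ev3 order_tendstoD(1)[OF limA Dpos]
    proof eventually_elim
      case (elim p)
      note E = ext[OF elim(1)]
      have q1: "q p \<ge> 1" using assms(3) elim by (simp add: N_def)
      have e0: "e p \<ge> 0" using elim N by (simp add: e_def)
      have md: "\<bar>m p * d x - d x / D\<bar> \<le> \<bar>m p - 1 / D\<bar> * R" if "x \<in> \<Omega>" for x
      proof -
        have "m p * d x - d x / D = (m p - 1 / D) * d x" by (simp add: left_diff_distrib)
        then show ?thesis using R'[OF that] d0[of x] by (simp add: abs_mult mult_left_mono)
      qed
      have "\<bar>u p x - d x / D\<bar> \<le> \<eta>" if x: "x \<in> \<Omega>" for x
      proof (rule ccontr)
        assume "\<not> ?thesis"
        moreover have "u p x - d x / D \<le> \<eta>"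
        proof -
          have "u p x \<le> m p * (d x + e p)" using E x by blast
          then show ?thesis using md[OF x] elim(2) by (simp add: distrib_left abs_le_iff)
        qed
        ultimately have low: "u p x < d x / D - \<eta>" by linarith
        have "0 < u p x" using E x by blast
        then have "\<eta> < d x / D" using low by simp
        \<comment> \<open>Positivity of \<open>u p x\<close> keeps any point with a downward gap at
          distance more than \<open>\<eta>\<close> D from the boundary, so the whole ball fits into
          \<open>\<Omega>\<close>.\<close>
        then have "\<rho> \<le> d x" using D \<eta> d0[of x] by (simp add: \<rho>_def field_simps)
        then have sub: "ball x \<rho> \<subseteq> \<Omega>"
          using ball_boundary_dist_subset[OF \<Omega> x] unfolding d_def by (meson subset_ball subset_trans)
        have gap: "u p y powr q p + (\<eta> / 4) powr q p * indicator (ball x \<rho>) y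
            \<le> m p powr q p * (d y + e p) powr q p" if y: "y \<in> \<Omega>" for y
        proof -
          define w where "w = m p * (d y + e p)"
          have uw: "0 < u p y" "u p y \<le> w" using E y by (auto simp: w_def)
          have "u p y powr q p + (\<eta> / 4) powr q p * indicator (ball x \<rho>) y \<le> w powr q p"
          proof (cases "y \<in> ball x \<rho>")
            case True
            then have dxy: "dist x y < \<rho>" by simp
            have "\<bar>u p y - u p x\<bar> \<le> m p * (dist y x + e p)" using E x y by blast
            also have "\<dots> \<le> m p * (\<rho> + e p)"
              using dxy m0 by (intro mult_left_mono) (auto simp: dist_commute)
            finally have "u p y \<le> u p x + m p * (\<rho> + e p)" by linarith
            moreover have "m p * (d x - \<rho> + e p) \<le> w"
              unfolding w_def using dlip[of x y] dxy m0 by (intro mult_left_mono) auto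
            \<comment> \<open>One \<open>m p\<close> \<open>\<rho>\<close> is lost because
              \<open>u p\<close> may rise away from \<open>x\<close>, another because
              \<open>d\<close> may fall; the errors \<open>e p\<close> cancel.\<close>
            ultimately have "w - u p y \<ge> m p * d x - u p x - 2 * m p * \<rho>"
              by (simp add: algebra_simps)
            then have "\<eta> / 4 \<le> w - u p y"
              using low md[OF x] elim(3) by (simp add: abs_le_iff)
            then have "u p y powr q p + (\<eta> / 4) powr q p \<le> u p y powr q p + (w - u p y) powr q p"
              using q1 \<eta> by (intro add_left_mono powr_mono2) auto
            also have "\<dots> \<le> w powr q p"
              using powr_superadditive[of "u p y" "w - u p y" "q p"] uw q1 by simp
            finally show ?thesis using True by simp
          next
            case False
            then show ?thesis using uw q1 by (auto intro!: powr_mono2)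
          qed
          then show ?thesis using m0 d0 e0 by (simp add: w_def powr_mult)
        qed
        have E_int: "(\<integral>y. u p y powr q p \<partial>?M) = 1" "integrable ?M (\<lambda>y. u p y powr q p)"
          using E by blast+
        have bm: "ball x \<rho> \<in> sets ?M"
          using sub \<Omega>(1) by (simp add: sets_restrict_space_iff)
        have bi: "integrable ?M (\<lambda>y. (\<eta> / 4) powr q p * indicator (ball x \<rho>) y)"
        proof (rule integrable_domain_bounded[OF \<Omega>])
          show "(\<lambda>y. (\<eta> / 4) powr q p * indicator (ball x \<rho>) y) \<in> borel_measurable ?M"
            by (intro borel_measurable_times borel_measurable_const borel_measurable_indicator bm)
          show "\<bar>(\<eta> / 4) powr q p * indicator (ball x \<rho>) y\<bar> \<le> (\<eta> / 4) powr q p" for y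
            by (simp add: indicator_def)
        qed
        have i: "integrable ?M (\<lambda>x. (d x + e p) powr q p)"
          using elim(5) by (metis not_integrable_integral_eq less_irrefl)
        \<comment> \<open>Integrating the pointwise gap over \<open>\<Omega>\<close> contradicts the
          norm budget.\<close>
        have "1 + (\<eta> / 4) powr q p * \<kappa> = (\<integral>y. u p y powr q p \<partial>?M) + (\<integral>y. (\<eta> / 4) powr q p * indicator (ball x \<rho>) y \<partial>?M)"
        proof -
          have "measure ?M (ball x \<rho>) = \<kappa>"
            using sub \<Omega>(1) ball_\<kappa>[of x] by (simp add: measure_restrict_space)
          moreover have "ball x \<rho> \<inter> \<Omega> = ball x \<rho>" using sub by blast
          ultimately show ?thesis by (simp add: E_int)
        qed
        also have "\<dots> = (\<integral>y. u p y powr q p + (\<eta> / 4) powr q p * indicator (ball x \<rho>) y \<partial>?M)"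
          by (intro Bochner_Integration.integral_add[symmetric] E_int bi)
        also have "\<dots> \<le> (\<integral>y. m p powr q p * (d y + e p) powr q p \<partial>?M)"
        proof (rule integral_mono)
          show "integrable ?M (\<lambda>y. u p y powr q p + (\<eta> / 4) powr q p * indicator (ball x \<rho>) y)"
            by (intro Bochner_Integration.integrable_add E_int bi)
          show "integrable ?M (\<lambda>y. m p powr q p * (d y + e p) powr q p)"
            by (intro integrable_mult_right i)
        qed (use gap in simp)
        also have "\<dots> = m p powr q p * (\<integral>x. (d x + e p) powr q p \<partial>?M)" by simp
        finally show False using elim(4) by simp
      qed
      then have near: "\<forall>x\<in>\<Omega>. norm (u p x - d x / D) \<le> \<eta>" by simp
      have "continuous_on (closure \<Omega>) (u p)" using E by blast
      then have cont: "continuous_on (closure \<Omega>) (\<lambda>x. u p x - d x / D)"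
        using D unfolding d_def by (intro continuous_intros continuous_on_boundary_dist[OF \<Omega>]) auto
      have "dist (u p x) (d x / D) < \<delta>" if "x \<in> closure \<Omega>" for x
        using continuous_on_closure_norm_le[OF cont near that] \<eta>(2) by (simp add: dist_norm)
      then show ?case by blast
    qed
  qed
  then show ?thesis
    using Lam_lim D_eq unfolding Lam_def d_def by (simp add: inverse_eq_divide)
qed

end
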